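(* Let $\beta\in\{1,2,4\}$ and for each $N\ge1$ let $\lambda_1,\dots,\lambda_N>0$ have joint density proportional to $\prod_{i<j}|\lambda_i-\lambda_j|^{\beta}\prod_{k=1}^N\lambda_k^{\beta N/2}e^{-\beta N\lambda_k/2}$ on $(0,\infty)^N$. For $\kappa\ge0$ let $\mathcal{T}_\kappa=\frac1N\sum_{i=1}^N\lambda_i^{-\kappa}$ (this equals $N^{\kappa-1}\mathrm{Tr}\,Q^\kappa$ for the Wigner–Smith time-delay matrix $Q$ with eigenvalues $\tau_i=(N\lambda_i)^{-1}$), and for $v\ge1$ and $\kappa_1,\dots,\kappa_v\ge0$ define $$\alpha[\kappa_1,\dots,\kappa_v]=\beta^{v-1}\lim_{N\to\infty}N^{2(v-1)}C_v(\mathcal{T}_{\kappa_1},\dots,\mathcal{T}_{\kappa_v}),$$ which is independent of $\beta$. Then: (i) $\alpha[\kappa]\in\mathbb{N}$ for all $\kappa\ge0$; (ii) $\alpha[\kappa_1,\kappa_2]\in\mathbb{N}$ for all $\kappa_1,\kappa_2\ge0$; (iii) $\alpha[\kappa_1,\kappa_2,\kappa_3]\in\mathbb{N}$ for all $\kappa_1,\kappa_2,\kappa_3\ge0$; (iv) $\alpha[1,1,\dots,1]\in\mathbb{N}$ ($v$ entries equal to $1$) for all $v\ge1$.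
   Context: $C_v(\xi_1,\dots,\xi_v)$ denotes the joint cumulant: $C_v(\xi_1,\dots,\xi_v)=\sum_{\pi}(|\pi|-1)!(-1)^{|\pi|-1}\prod_{P\in\pi}\langle\prod_{i\in P}\xi_i\rangle$, summed over set partitions $\pi$ of $\{1,\dots,v\}$, with $\langle\cdot\rangle$ the expectation. The existence of the limits and the independence of $\alpha$ from $\beta$ are part of the setting. $\mathbb{N}$ denotes the nonnegative integers. *)

theory Defs
  imports "HOL-Analysis.Analysis" "HOL-Library.Disjoint_Sets"
begin

definition ws_weight :: "real \<Rightarrow> nat \<Rightarrow> (nat \<Rightarrow> real) \<Rightarrow> real" where
  "ws_weight \<beta> N x =
     (if (\<forall>k<N. x k > 0) then
        (\<Prod>i<N. \<Prod>j\<in>{i<..<N}. \<bar>x i - x j\<bar> powr \<beta>) *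
        (\<Prod>k<N. x k powr (\<beta> * real N / 2) * exp (- \<beta> * real N * x k / 2))
      else 0)"

definition ws_space :: "nat \<Rightarrow> (nat \<Rightarrow> real) measure" where
  "ws_space N = PiM {..<N} (\<lambda>_. lborel)"

definition ws_expect :: "real \<Rightarrow> nat \<Rightarrow> ((nat \<Rightarrow> real) \<Rightarrow> real) \<Rightarrow> real" where
  "ws_expect \<beta> N f =
     (\<integral>x. f x * ws_weight \<beta> N x \<partial>ws_space N) / (\<integral>x. ws_weight \<beta> N x \<partial>ws_space N)"

definition ws_T :: "nat \<Rightarrow> nat \<Rightarrow> (nat \<Rightarrow> real) \<Rightarrow> real" where
  "ws_T \<kappa> N x = (1 / real N) * (\<Sum>i<N. 1 / x i ^ \<kappa>)"

definition ws_cumulant :: "real \<Rightarrow> nat \<Rightarrow> nat list \<Rightarrow> real" where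
  "ws_cumulant \<beta> N ks =
     (\<Sum>\<pi>\<in>{\<pi>. partition_on {..<length ks} \<pi>}.
        fact (card \<pi> - 1) * (-1) ^ (card \<pi> - 1) *
        (\<Prod>P\<in>\<pi>. ws_expect \<beta> N (\<lambda>x. \<Prod>i\<in>P. ws_T (ks ! i) N x)))"

definition alpha_in_Nat :: "real \<Rightarrow> nat list \<Rightarrow> bool" where
  "alpha_in_Nat \<beta> ks \<longleftrightarrow>
     (\<exists>m::nat. (\<lambda>N. \<beta> ^ (length ks - 1) * real N ^ (2 * (length ks - 1)) * ws_cumulant \<beta> N ks)
                  \<longlonglongrightarrow> real m)"

end

theory Submission
  imports Defs "HOL-Library.Sublist" "HOL-Library.Landau_Symbols" "HOL-Real_Asymp.Real_Asymp"
begin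

text \<open>
  Integrating the divergence of the vector field with components \<open>x\<^sub>i\<^sup>-\<^sup>k \<Prod>\<^sub>j T\<^bsub>\<kappa> j\<^esub>\<close> against the
  density gives a loop equation expressing \<open>E[T\<^bsub>k+1\<^esub> \<Prod>\<^sub>j T\<^bsub>\<kappa> j\<^esub>]\<close> by moments of the same or lower
  total degree. For the rescaled joint cumulants \<open>c = (\<beta> N\<^sup>2)\<^bsup>v-1\<^esup> C\<^sub>v\<close> it becomes
  \<open>(1 + k (1 - 2/\<beta>) / N) c[k+1, S] = c[k, S]
     + \<Sum>\<^bsub>a+b=k+1\<^esub> (c[a, b, S] / (\<beta> N\<^sup>2) + \<Sum>\<^bsub>I \<subseteq> S\<^esub> c[a, I] c[b, S - I])
     + 2 \<Sum>\<^bsub>j \<in> S\<^esub> \<kappa>\<^sub>j c[\<kappa>\<^sub>j + k + 1, S - j]\<close>,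
  where a and b are positive.
  In the limit the terms \<open>c[a, b, S]\<close> disappear and what remains is a recursion with
  coefficients in the natural numbers, so all limits, for every v, are natural numbers.
\<close>

section \<open>Joint cumulants\<close>

definition moebius_coeff :: "nat \<Rightarrow> 'b::{comm_ring_1,semiring_char_0}" where
  "moebius_coeff n = fact (n - 1) * (-1) ^ (n - 1)"

definition joint_cumulant :: "('a set \<Rightarrow> 'b::{comm_ring_1,semiring_char_0}) \<Rightarrow> 'a set \<Rightarrow> 'b" where
  "joint_cumulant m S = (\<Sum>\<pi> | partition_on S \<pi>. moebius_coeff (card \<pi>) * (\<Prod>P\<in>\<pi>. m P))"

lemma moebius_coeff_recurrence:
  assumes "n > 0"
  shows "moebius_coeff n + of_nat (n - 1) * moebius_coeff (n - 1) = of_bool (n = 1)"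
proof (cases "n = 1")
  case False
  with assms obtain l where "n = Suc (Suc l)"
    by (intro that[of "n - 2"]) simp
  then show ?thesis by (simp add: moebius_coeff_def)
qed (simp add: moebius_coeff_def)

lemma complement_notin_partition:
  assumes "partition_on (insert s I) \<pi>" "I \<in> Pow S - {S}" "s \<notin> S"
  shows "S - I \<notin> \<pi>"
proof
  assume "S - I \<in> \<pi>"
  then have "S - I \<subseteq> insert s I"
    using assms(1) by (auto simp: partition_on_def)
  then show False
    using assms(2,3) by auto
qed

lemma partition_on_insert_complement:
  assumes "partition_on (insert s I) \<pi>" "I \<in> Pow S - {S}" "s \<notin> S"
  shows "partition_on (insert s S) (insert (S - I) \<pi>)"
  using assms unfolding partition_on_def disjoint_def by auto

lemma partition_on_remove_block:
  assumes "partition_on S \<rho>" "B \<in> \<rho>"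
  shows "partition_on (S - B) (\<rho> - {B})"
proof -
  have disj: "P \<inter> Q = {}" if "P \<in> \<rho>" "Q \<in> \<rho>" "P \<noteq> Q" for P Q
    using that assms(1) by (auto simp: partition_on_def disjoint_def)
  then have "\<Union>(\<rho> - {B}) = S - B"
    using disj[OF _ assms(2)] by (auto simp: partition_onD1[OF assms(1)])
  then show ?thesis
    using disj partition_onD3[OF assms(1)] by (auto simp: partition_on_def disjoint_def)
qed

lemma bij_betw_partition_marked_block:
  assumes "s \<notin> S"
  shows "bij_betw (\<lambda>(I, \<pi>). (insert (S - I) \<pi>, S - I))
     (SIGMA I:Pow S - {S}. {\<pi>. partition_on (insert s I) \<pi>})
     (SIGMA \<rho>:{\<rho>. partition_on (insert s S) \<rho>}. {B \<in> \<rho>. s \<notin> B})"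
proof -
  have block_subset: "B \<subseteq> S" and block_nonempty: "B \<noteq> {}"
    if "partition_on (insert s S) \<rho>" "B \<in> \<rho>" "s \<notin> B" for \<rho> B
    using that by (auto simp: partition_on_def)
  show ?thesis
  proof (rule bij_betw_byWitness[where f' = "\<lambda>(\<rho>, B). (S - B, \<rho> - {B})"], goal_cases)
    case 1
    then show ?case
      using complement_notin_partition[OF _ _ assms] by fastforce
  next
    case 2
    then show ?case
      using block_subset by (auto simp: insert_absorb double_diff)
  next
    case 3
    then show ?case
      using partition_on_insert_complement[OF _ _ assms] assms by auto
  next
    case 4
    have "partition_on (insert s (S - B)) (\<rho> - {B}) \<and> S - B \<noteq> S"
      if "partition_on (insert s S) \<rho>" "B \<in> \<rho>" "s \<notin> B" for \<rho> B
    proof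
      show "partition_on (insert s (S - B)) (\<rho> - {B})"
        using partition_on_remove_block[OF that(1,2)] that(3) by (simp add: insert_Diff_if)
      show "S - B \<noteq> S"
        using block_subset[OF that] block_nonempty[OF that] by blast
    qed
    then show ?case by auto
  qed
qed

lemma card_blocks_avoiding:
  assumes "partition_on S \<rho>" "s \<in> S"
  shows "card {B \<in> \<rho>. s \<notin> B} = card \<rho> - 1"
proof -
  obtain B where "B \<in> \<rho>" "s \<in> B"
    using assms unfolding partition_on_def by blast
  moreover from this have "{B \<in> \<rho>. s \<notin> B} = \<rho> - {B}"
    using assms(1) unfolding partition_on_def disjoint_def by blast
  ultimately show ?thesis by simp
qed

lemma partition_on_card_eq_1_iff:
  assumes "partition_on S \<rho>"
  shows "card \<rho> = 1 \<longleftrightarrow> \<rho> = {S}"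
  using assms by (auto simp: partition_on_def card_1_singleton_iff)

lemma sum_joint_cumulant_proper_subsets:
  fixes m :: "'a set \<Rightarrow> 'b::{comm_ring_1,semiring_char_0}"
  assumes "finite S" "s \<notin> S"
  shows "(\<Sum>I\<in>Pow S - {S}. joint_cumulant m (insert s I) * m (S - I))
    = (\<Sum>\<rho> | partition_on (insert s S) \<rho>. of_nat (card \<rho> - 1) * moebius_coeff (card \<rho> - 1) * (\<Prod>P\<in>\<rho>. m P))"
proof -
  let ?part = "\<lambda>I. {\<pi>. partition_on (insert s I) \<pi>}"
  have finite_blocks: "finite \<rho>" if "partition_on (insert s S) \<rho>" for \<rho>
    using assms(1) that by (intro finite_elements[of "insert s S"]) simp_all
  have "(\<Sum>I\<in>Pow S - {S}. joint_cumulant m (insert s I) * m (S - I))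
      = (\<Sum>(I, \<pi>)\<in>(SIGMA I:Pow S - {S}. ?part I). moebius_coeff (card \<pi>) * (\<Prod>P\<in>\<pi>. m P) * m (S - I))"
    using assms(1) unfolding joint_cumulant_def sum_distrib_right
    by (intro sum.Sigma) (auto intro!: finitely_many_partition_on intro: finite_subset)
  also have "\<dots> = (\<Sum>(\<rho>, B)\<in>(SIGMA \<rho>:?part S. {B \<in> \<rho>. s \<notin> B}). moebius_coeff (card \<rho> - 1) * (\<Prod>P\<in>\<rho>. m P))"
  proof (subst sum.reindex_bij_betw[OF bij_betw_partition_marked_block[OF assms(2)], symmetric],
      rule sum.cong[OF refl])
    fix p assume "p \<in> (SIGMA I:Pow S - {S}. ?part I)"
    then obtain I \<pi> where p: "p = (I, \<pi>)" and I: "I \<in> Pow S - {S}" and \<pi>: "partition_on (insert s I) \<pi>"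
      by blast
    have "S - I \<notin> \<pi>"
      using \<pi> I assms(2) by (rule complement_notin_partition)
    moreover have "finite (insert s I)"
      using I assms(1) by (auto intro: finite_subset)
    then have "finite \<pi>"
      using \<pi> by (rule finite_elements)
    ultimately show "(case p of (I, \<pi>) \<Rightarrow> moebius_coeff (card \<pi>) * (\<Prod>P\<in>\<pi>. m P) * m (S - I)) =
        (case case p of (I, \<pi>) \<Rightarrow> (insert (S - I) \<pi>, S - I) of
           (\<rho>, B) \<Rightarrow> moebius_coeff (card \<rho> - 1) * (\<Prod>P\<in>\<rho>. m P))"
      by (simp add: p)
  qed
  also have "\<dots> = (\<Sum>\<rho>\<in>?part S. of_nat (card \<rho> - 1) * moebius_coeff (card \<rho> - 1) * (\<Prod>P\<in>\<rho>. m P))"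
    using assms(1) finitely_many_partition_on[of "insert s S"] finite_blocks
      card_blocks_avoiding[of "insert s S" _ s]
    by (subst sum.Sigma[symmetric]) (auto simp: mult.assoc)
  finally show ?thesis .
qed

text \<open>
  By the previous lemma, a partition into \<open>n\<close> blocks arises from \<open>I = S\<close> with the coefficient of
  \<open>n\<close> and from its \<open>n - 1\<close> blocks avoiding \<open>s\<close> with that of \<open>n - 1\<close>. These cancel unless \<open>n = 1\<close>.
\<close>
lemma moment_eq_sum_joint_cumulant:
  fixes m :: "'a set \<Rightarrow> 'b::{comm_ring_1,semiring_char_0}"
  assumes "finite S" "s \<notin> S" "m {} = 1"
  shows "m (insert s S) = (\<Sum>I\<in>Pow S. joint_cumulant m (insert s I) * m (S - I))"
proof -
  let ?P = "{\<rho>. partition_on (insert s S) \<rho>}"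
  have "finite ?P"
    using assms(1) finitely_many_partition_on[of "insert s S"] by simp
  have "(\<Sum>I\<in>Pow S. joint_cumulant m (insert s I) * m (S - I))
      = joint_cumulant m (insert s S) + (\<Sum>I\<in>Pow S - {S}. joint_cumulant m (insert s I) * m (S - I))"
    using assms(1,3) by (subst sum.remove[of _ S]) auto
  also have "\<dots> = (\<Sum>\<rho>\<in>?P.
      (moebius_coeff (card \<rho>) + of_nat (card \<rho> - 1) * moebius_coeff (card \<rho> - 1)) * (\<Prod>P\<in>\<rho>. m P))"
    unfolding sum_joint_cumulant_proper_subsets[OF assms(1,2)]
    by (simp add: joint_cumulant_def sum.distrib distrib_right)
  also have "\<dots> = (\<Sum>\<rho>\<in>?P. if \<rho> = {insert s S} then m (insert s S) else 0)"
  proof (rule sum.cong[OF refl])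
    fix \<rho> assume "\<rho> \<in> ?P"
    then have \<rho>: "partition_on (insert s S) \<rho>"
      by simp
    then have "finite \<rho>" "\<rho> \<noteq> {}"
      using assms(1) finite_elements[OF _ \<rho>] by (auto simp: partition_on_def)
    then have card_pos: "card \<rho> > 0"
      by (simp add: card_gt_0_iff)
    show "(moebius_coeff (card \<rho>) + of_nat (card \<rho> - 1) * moebius_coeff (card \<rho> - 1)) * (\<Prod>P\<in>\<rho>. m P)
        = (if \<rho> = {insert s S} then m (insert s S) else 0)"
      unfolding moebius_coeff_recurrence[OF card_pos] partition_on_card_eq_1_iff[OF \<rho>] by simp
  qed
  also have "\<dots> = m (insert s S)"
    using \<open>finite ?P\<close> partition_on_space[of "insert s S"] by simp
  finally show ?thesis by simp
qed

lemma partition_on_image_iff: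
  assumes inj: "inj_on f A" and "\<pi> \<subseteq> Pow A"
  shows "partition_on (f ` A) ((`) f ` \<pi>) \<longleftrightarrow> partition_on A \<pi>"
proof
  assume "partition_on A \<pi>"
  moreover from this have "(`) f ` \<pi> - {{}} = (`) f ` \<pi>"
    by (auto simp: partition_on_def)
  ultimately show "partition_on (f ` A) ((`) f ` \<pi>)"
    using partition_on_inj_image[OF _ inj] by metis
next
  assume p: "partition_on (f ` A) ((`) f ` \<pi>)"
  show "partition_on A \<pi>"
  proof (rule partition_onI)
    have "f ` \<Union>\<pi> = f ` A"
      using p by (auto simp: partition_on_def image_Union)
    then show "\<Union>\<pi> = A"
      using inj_on_image_eq_iff[OF inj, of "\<Union>\<pi>" A] assms(2) by auto
    show "disjnt P Q" if "P \<in> \<pi>" "Q \<in> \<pi>" "P \<noteq> Q" for P Q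
    proof -
      have "f ` P \<noteq> f ` Q"
        using that assms(2) by (subst inj_on_image_eq_iff[OF inj]) auto
      then have "f ` P \<inter> f ` Q = {}"
        using p that by (auto simp: partition_on_def disjoint_def)
      then show ?thesis by (auto simp: disjnt_def)
    qed
    show "{} \<notin> \<pi>"
      using p by (auto simp: partition_on_def)
  qed
qed

lemma bij_betw_image_partitions:
  assumes inj: "inj_on f A"
  shows "bij_betw ((`) ((`) f)) {\<pi>. partition_on A \<pi>} {\<rho>. partition_on (f ` A) \<rho>}"
proof -
  have "bij_betw ((`) ((`) f)) (Pow (Pow A)) (Pow (Pow (f ` A)))"
    using inj by (intro bij_betw_Pow inj_on_imp_bij_betw)
  then have "bij_betw ((`) ((`) f)) {\<pi> \<in> Pow (Pow A). partition_on A \<pi>}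
      {\<rho> \<in> Pow (Pow (f ` A)). partition_on (f ` A) \<rho>}"
    by (rule bij_betw_Collect) (simp add: partition_on_image_iff[OF inj] subset_Pow_Union)
  moreover have "{\<pi> \<in> Pow (Pow A). partition_on A \<pi>} = {\<pi>. partition_on A \<pi>}"
    "{\<rho> \<in> Pow (Pow (f ` A)). partition_on (f ` A) \<rho>} = {\<rho>. partition_on (f ` A) \<rho>}"
    by (auto simp: partition_on_def)
  ultimately show ?thesis by (simp only:)
qed

lemma joint_cumulant_image:
  assumes inj: "inj_on f A"
  shows "joint_cumulant m (f ` A) = joint_cumulant (\<lambda>P. m (f ` P)) A"
  unfolding joint_cumulant_def
proof (subst sum.reindex_bij_betw[OF bij_betw_image_partitions[OF inj], symmetric],
    rule sum.cong[OF refl], clarify)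
  fix \<pi> assume "partition_on A \<pi>"
  then have "inj_on ((`) f) \<pi>"
    by (intro inj_on_subset[OF inj_on_image_Pow[OF inj]]) (auto simp: partition_on_def)
  then show "moebius_coeff (card ((`) f ` \<pi>)) * (\<Prod>P\<in>(`) f ` \<pi>. m P) =
      moebius_coeff (card \<pi>) * (\<Prod>P\<in>\<pi>. m (f ` P))"
    by (simp add: card_image prod.reindex)
qed

lemma joint_cumulant_cong:
  assumes "\<And>P. P \<subseteq> S \<Longrightarrow> m P = m' P"
  shows "joint_cumulant m S = joint_cumulant m' S"
  unfolding joint_cumulant_def
proof (rule sum.cong[OF refl])
  fix \<pi> assume "\<pi> \<in> {\<pi>. partition_on S \<pi>}"
  then have "(\<Prod>P\<in>\<pi>. m P) = (\<Prod>P\<in>\<pi>. m' P)"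
    by (intro prod.cong assms) (auto simp: partition_on_def)
  then show "moebius_coeff (card \<pi>) * (\<Prod>P\<in>\<pi>. m P) = moebius_coeff (card \<pi>) * (\<Prod>P\<in>\<pi>. m' P)"
    by simp
qed

section \<open>Convolution of functions on lists\<close>

definition list_convolution :: "('a list \<Rightarrow> 'b::comm_semiring_0) \<Rightarrow> ('a list \<Rightarrow> 'b) \<Rightarrow> 'a list \<Rightarrow> 'b"
    (infixl "\<star>" 70) where
  "(f \<star> g) xs = (\<Sum>I\<in>Pow {..<length xs}. f (nths xs I) * g (nths xs ({..<length xs} - I)))"

definition sum_extract :: "('a \<Rightarrow> 'a list \<Rightarrow> 'b::comm_monoid_add) \<Rightarrow> 'a list \<Rightarrow> 'b" where
  "sum_extract f xs = (\<Sum>i<length xs. f (xs ! i) (nths xs (- {i})))"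

lemma sum_Pow_insert:
  assumes "finite S" "s \<notin> S"
  shows "(\<Sum>I\<in>Pow (insert s S). f I) = (\<Sum>I\<in>Pow S. f (insert s I)) + (\<Sum>I\<in>Pow S. f I)"
proof -
  have "inj_on (insert s) (Pow S)"
    using assms(2) by (auto simp: inj_on_def)
  then have "(\<Sum>I\<in>insert s ` Pow S. f I) = (\<Sum>I\<in>Pow S. f (insert s I))"
    by (simp add: sum.reindex)
  then show ?thesis
    unfolding Pow_insert using assms by (subst sum.union_disjoint) (auto simp: add.commute)
qed

lemma sum_Pow_image:
  assumes "inj_on h S"
  shows "(\<Sum>I\<in>Pow (h ` S). f I) = (\<Sum>I\<in>Pow S. f (h ` I))"
  using sum.reindex_bij_betw[OF bij_betw_image_Pow[OF inj_on_imp_bij_betw[OF assms]], of f] by simp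

lemma nths_Cons_insert_0: "nths (x # xs) (insert 0 (Suc ` I)) = x # nths xs I"
  and nths_Cons_Suc_image: "nths (x # xs) (Suc ` I) = nths xs I"
  by (simp_all add: nths_Cons image_iff)

lemma list_convolution_Nil [simp]: "(f \<star> g) [] = f [] * g []"
  by (simp add: list_convolution_def)

lemma list_convolution_Cons [simp]:
  "(f \<star> g) (x # xs) = ((\<lambda>ys. f (x # ys)) \<star> g) xs + (f \<star> (\<lambda>ys. g (x # ys))) xs"
proof -
  let ?n = "length xs"
  have diff: "Suc ` {..<?n} - Suc ` I = Suc ` ({..<?n} - I)"
    "insert 0 (Suc ` {..<?n}) - Suc ` I = insert 0 (Suc ` ({..<?n} - I))" for I
    by auto
  show ?thesis
    unfolding list_convolution_def length_Cons lessThan_Suc_eq_insert_0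
    by (simp add: sum_Pow_insert sum_Pow_image diff nths_Cons_insert_0 nths_Cons_Suc_image)
qed

lemma sum_extract_Nil [simp]: "sum_extract f [] = 0"
  by (simp add: sum_extract_def)

lemma nths_Cons_Compl_singleton:
  "nths (x # xs) (- {0}) = xs" "nths (x # xs) (- {Suc i}) = x # nths xs (- {i})"
  by (simp_all add: nths_Cons nths_all Compl_eq)

lemma sum_extract_Cons [simp]:
  "sum_extract f (x # xs) = f x xs + sum_extract (\<lambda>y ys. f y (x # ys)) xs"
  by (simp add: sum_extract_def nths_Cons_Compl_singleton sum.lessThan_Suc_shift del: sum.lessThan_Suc)

lemma mset_nth_nths:
  "i < length xs \<Longrightarrow> add_mset (xs ! i) (mset (nths xs (- {i}))) = mset xs"
proof (induction xs arbitrary: i)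
  case (Cons x xs)
  then show ?case
    by (cases i) (auto simp: nths_Cons_Compl_singleton add_mset_commute)
qed simp

lemma sum_extract_cong [fundef_cong]:
  assumes "xs = xs'" "\<And>y ys. add_mset y (mset ys) = mset xs' \<Longrightarrow> f y ys = f' y ys"
  shows "sum_extract f xs = sum_extract f' xs'"
  unfolding sum_extract_def assms(1) using mset_nth_nths by (intro sum.cong refl assms(2)) auto

lemma list_convolution_cong [fundef_cong]:
  assumes "xs = xs'" "\<And>ys. subseq ys xs' \<Longrightarrow> f ys = f' ys" "\<And>ys. subseq ys xs' \<Longrightarrow> g ys = g' ys"
  shows "(f \<star> g) xs = (f' \<star> g') xs'"
  unfolding list_convolution_def assms(1)
  by (intro sum.cong arg_cong2[where f = "(*)"] assms(2,3)) (auto simp: subseq_conv_nths)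

lemma
  fixes f :: "'a list \<Rightarrow> 'b::comm_semiring_0"
  shows list_convolution_add_left: "((\<lambda>ys. f ys + f' ys) \<star> g) xs = (f \<star> g) xs + (f' \<star> g) xs"
    and list_convolution_add_right: "(f \<star> (\<lambda>ys. g ys + g' ys)) xs = (f \<star> g) xs + (f \<star> g') xs"
    and list_convolution_mult_left: "((\<lambda>ys. a * f ys) \<star> g) xs = a * (f \<star> g) xs"
    and list_convolution_sum_left: "((\<lambda>ys. \<Sum>i\<in>A. h i ys) \<star> g) xs = (\<Sum>i\<in>A. (h i \<star> g) xs)"
  by (simp_all add: list_convolution_def distrib_left distrib_right sum.distrib sum_distrib_left
      sum_distrib_right mult.assoc sum.swap[of _ A])

lemma list_convolution_assoc: "((f \<star> g) \<star> h) xs = (f \<star> (g \<star> h)) xs"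
  by (induction xs arbitrary: f g h)
    (simp_all add: list_convolution_add_left list_convolution_add_right mult.assoc add.assoc)

lemma list_convolution_unit: "((\<lambda>ys. of_bool (ys = [])) \<star> f) xs = f xs"
  for f :: "'a list \<Rightarrow> 'b::comm_semiring_1"
proof -
  have "((\<lambda>_. 0) \<star> g) ys = 0" for g :: "'a list \<Rightarrow> 'b" and ys
    by (simp add: list_convolution_def)
  then show ?thesis by (induction xs arbitrary: f) simp_all
qed

lemma sum_extract_add: "sum_extract (\<lambda>y ys. f y ys + g y ys) xs = sum_extract f xs + sum_extract g xs"
  by (simp add: sum_extract_def sum.distrib)

lemma sum_extract_mult_left: "sum_extract (\<lambda>y ys. a * f y ys) xs = a * sum_extract f xs"
  for a :: "'b::semiring_0"
  by (simp add: sum_extract_def sum_distrib_left)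

lemma sum_extract_convolution: "(sum_extract f \<star> g) xs = sum_extract (\<lambda>y. f y \<star> g) xs"
  by (induction xs arbitrary: f g) (simp_all add: list_convolution_add_left sum_extract_add add.assoc)

lemma length_nths_subset:
  assumes "I \<subseteq> {..<length xs}"
  shows "length (nths xs I) = card I"
proof -
  have "{i. i < length xs \<and> i \<in> I} = I"
    using assms by auto
  then show ?thesis by (simp add: length_nths)
qed

lemma list_convolution_length_power:
  fixes h :: "'b::comm_semiring_1"
  shows "((\<lambda>ys. h ^ length ys * f ys) \<star> (\<lambda>ys. h ^ length ys * g ys)) xs = h ^ length xs * (f \<star> g) xs"
  unfolding list_convolution_def sum_distrib_left
proof (rule sum.cong[OF refl])
  fix I assume "I \<in> Pow {..<length xs}"
  then have I: "I \<subseteq> {..<length xs}" by simp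
  then have "card I + card ({..<length xs} - I) = length xs"
    using card_Un_disjoint[of I "{..<length xs} - I"]
    by (simp add: finite_subset Un_absorb1)
  then have "h ^ length xs = h ^ length (nths xs I) * h ^ length (nths xs ({..<length xs} - I))"
    by (simp add: length_nths_subset I flip: power_add)
  then show "h ^ length (nths xs I) * f (nths xs I) *
      (h ^ length (nths xs ({..<length xs} - I)) * g (nths xs ({..<length xs} - I))) =
      h ^ length xs * (f (nths xs I) * g (nths xs ({..<length xs} - I)))"
    by (simp only: mult_ac)
qed

lemma list_convolution_cancel:
  fixes f g :: "'a list \<Rightarrow> 'b::comm_ring_1"
  assumes "m [] = 1" "\<And>ys. subseq ys xs \<Longrightarrow> (f \<star> m) ys = (g \<star> m) ys"
  shows "f xs = g xs"
  using assms(2)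
proof (induction "length xs" arbitrary: xs rule: less_induct)
  case less
  let ?X = "{..<length xs}"
  have split_top: "(h \<star> m) xs = h xs + (\<Sum>I\<in>Pow ?X - {?X}. h (nths xs I) * m (nths xs (?X - I)))" for h
    unfolding list_convolution_def using assms(1) by (subst sum.remove[of _ ?X]) (auto simp: nths_all)
  have "f (nths xs I) = g (nths xs I)" if "I \<in> Pow ?X - {?X}" for I
  proof (rule less.hyps)
    have "card I < card ?X"
      using that by (intro psubset_card_mono) auto
    then show "length (nths xs I) < length xs"
      using that by (simp add: length_nths_subset)
    have "subseq (nths xs I) xs"
      by (auto simp: subseq_conv_nths)
    then show "(f \<star> m) ys = (g \<star> m) ys" if "subseq ys (nths xs I)" for ys
      using that less.prems by (meson subseq_order.trans)
  qed
  then have "(\<Sum>I\<in>Pow ?X - {?X}. f (nths xs I) * m (nths xs (?X - I)))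
      = (\<Sum>I\<in>Pow ?X - {?X}. g (nths xs I) * m (nths xs (?X - I)))"
    by simp
  then show ?case
    using less.prems[of xs] by (simp add: split_top)
qed

section \<open>Cumulants of lists\<close>

definition list_cumulant :: "('a list \<Rightarrow> 'b::{comm_ring_1,semiring_char_0}) \<Rightarrow> 'a list \<Rightarrow> 'b" where
  "list_cumulant m xs = joint_cumulant (\<lambda>P. m (nths xs P)) {..<length xs}"

lemma joint_cumulant_nths:
  assumes "S \<subseteq> {..<length xs}"
  shows "joint_cumulant (\<lambda>P. m (nths xs P)) S = list_cumulant m (nths xs S)"
proof -
  define rank where "rank i = card {j \<in> S. j < i}" for i
  have "finite S"
    using assms finite_subset by blast
  have rank_less: "rank i < rank j" if "i \<in> S" "i < j" for i j
    unfolding rank_def using that \<open>finite S\<close> by (intro psubset_card_mono) auto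
  have inj: "inj_on rank S"
    by (rule linorder_inj_onI') (use rank_less in fastforce)
  have "rank i < card S" if "i \<in> S" for i
    unfolding rank_def using that \<open>finite S\<close> by (intro psubset_card_mono) auto
  then have rank_image: "rank ` S = {..<length (nths xs S)}"
    using \<open>finite S\<close> inj by (intro card_subset_eq) (auto simp: card_image length_nths_subset assms)
  have "nths (nths xs S) (rank ` P) = nths xs P" if "P \<subseteq> S" for P
  proof -
    have "{i \<in> S. \<exists>j \<in> rank ` P. rank i = j} = P"
      using that inj by (auto dest: inj_onD)
    then show ?thesis
      by (simp add: nths_nths flip: rank_def)
  qed
  then show ?thesis
    unfolding list_cumulant_def rank_image[symmetric] joint_cumulant_image[OF inj]
    by (intro joint_cumulant_cong) simp
qed

text \<open>
  Prepending \<open>x\<close> to the argument is a derivation of the convolution; with respect to it the cumulant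
  is the logarithmic derivative of \<open>m\<close>.
\<close>
lemma moment_Cons_eq_convolution:
  assumes "m [] = 1"
  shows "m (x # xs) = ((\<lambda>ys. list_cumulant m (x # ys)) \<star> m) xs"
proof -
  let ?S = "Suc ` {..<length xs}"
  define M where "M P = m (nths (x # xs) P)" for P
  have "m (x # xs) = M (insert 0 ?S)"
    by (simp add: M_def nths_all flip: lessThan_Suc_eq_insert_0)
  also have "\<dots> = (\<Sum>I\<in>Pow ?S. joint_cumulant M (insert 0 I) * M (?S - I))"
    by (rule moment_eq_sum_joint_cumulant) (auto simp: M_def assms)
  also have "\<dots> = (\<Sum>I\<in>Pow {..<length xs}.
      joint_cumulant M (insert 0 (Suc ` I)) * M (Suc ` ({..<length xs} - I)))"
    by (simp add: sum_Pow_image image_set_diff)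
  also have "\<dots> = ((\<lambda>ys. list_cumulant m (x # ys)) \<star> m) xs"
    unfolding list_convolution_def
  proof (rule sum.cong[OF refl])
    fix I assume "I \<in> Pow {..<length xs}"
    then have "insert 0 (Suc ` I) \<subseteq> {..<length (x # xs)}"
      by (auto simp: subset_iff)
    then have "joint_cumulant M (insert 0 (Suc ` I)) = list_cumulant m (x # nths xs I)"
      unfolding M_def by (simp only: joint_cumulant_nths nths_Cons_insert_0)
    then show "joint_cumulant M (insert 0 (Suc ` I)) * M (Suc ` ({..<length xs} - I)) =
        list_cumulant m (x # nths xs I) * m (nths xs ({..<length xs} - I))"
      by (simp add: M_def nths_Cons_Suc_image)
  qed
  finally show ?thesis .
qed

lemma list_cumulant_Cons_neutral:
  assumes "m [] = 1" "\<And>ys. m (x # ys) = m ys"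
  shows "list_cumulant m (x # xs) = of_bool (xs = [])"
proof (rule list_convolution_cancel[where f = "\<lambda>xs. list_cumulant m (x # xs)" and m = m, OF assms(1)])
  show "((\<lambda>xs. list_cumulant m (x # xs)) \<star> m) ys = ((\<lambda>ys. of_bool (ys = [])) \<star> m) ys" for ys
    by (simp add: assms list_convolution_unit flip: moment_Cons_eq_convolution)
qed

text \<open>The Leibniz rule applied to the previous identity.\<close>
lemma moment_Cons_Cons_eq_convolution:
  fixes m :: "'a list \<Rightarrow> 'b::{comm_ring_1,semiring_char_0}"
  assumes "m [] = 1"
  defines "K \<equiv> list_cumulant m"
  shows "m (x # y # xs) = ((\<lambda>zs. K (x # y # zs) + ((\<lambda>ys. K (x # ys)) \<star> (\<lambda>ys. K (y # ys))) zs) \<star> m) xs"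
proof -
  have "m (x # y # xs) = ((\<lambda>ys. K (x # y # ys)) \<star> m) xs + ((\<lambda>ys. K (x # ys)) \<star> (\<lambda>ys. m (y # ys))) xs"
    by (simp add: K_def moment_Cons_eq_convolution[of m x, OF assms(1)])
  also have "(\<lambda>ys. m (y # ys)) = (\<lambda>ys. K (y # ys)) \<star> m"
    by (simp add: K_def moment_Cons_eq_convolution[of m, OF assms(1)])
  finally show ?thesis
    by (simp add: list_convolution_add_left list_convolution_assoc)
qed

lemma list_cumulant_loop_equation:
  fixes m :: "nat list \<Rightarrow> 'b::{comm_ring_1,semiring_char_0}"
  assumes "m [] = 1"
    and loop: "\<And>ys. subseq ys xs \<Longrightarrow> r * m (Suc k # ys) = m (k # ys)
       + (\<Sum>a<k. m (Suc a # (k - a) # ys)) + e * sum_extract (\<lambda>j js. of_nat j * m ((j + k + 1) # js)) ys"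
  defines "K \<equiv> list_cumulant m"
  shows "r * K (Suc k # xs) = K (k # xs)
       + (\<Sum>a<k. K (Suc a # (k - a) # xs) + ((\<lambda>ys. K (Suc a # ys)) \<star> (\<lambda>ys. K ((k - a) # ys))) xs)
       + e * sum_extract (\<lambda>j js. of_nat j * K ((j + k + 1) # js)) xs"
    (is "_ = ?rhs xs")
proof (rule list_convolution_cancel[where f = "\<lambda>xs. r * K (Suc k # xs)" and g = ?rhs and m = m,
      OF assms(1)])
  fix ys assume "subseq ys xs"
  let ?pair = "\<lambda>a xs. K (Suc a # (k - a) # xs) + ((\<lambda>ys. K (Suc a # ys)) \<star> (\<lambda>ys. K ((k - a) # ys))) xs"
  have head: "((\<lambda>ys. K (j # ys)) \<star> m) zs = m (j # zs)" for j zs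
    by (simp only: K_def moment_Cons_eq_convolution[of m, OF assms(1)])
  have pair: "(?pair a \<star> m) ys = m (Suc a # (k - a) # ys)" for a
    by (simp only: K_def moment_Cons_Cons_eq_convolution[of m, OF assms(1)])
  have extraction: "(sum_extract (\<lambda>j js. of_nat j * K ((j + k + 1) # js)) \<star> m) ys
      = sum_extract (\<lambda>j js. of_nat j * m ((j + k + 1) # js)) ys"
    unfolding sum_extract_convolution
    by (rule sum_extract_cong[OF refl]) (simp only: list_convolution_mult_left head)
  have "(?rhs \<star> m) ys = ((\<lambda>ys. K (k # ys)) \<star> m) ys + (\<Sum>a<k. (?pair a \<star> m) ys)
      + e * (sum_extract (\<lambda>j js. of_nat j * K ((j + k + 1) # js)) \<star> m) ys"
    by (simp only: list_convolution_add_left list_convolution_sum_left list_convolution_mult_left)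
  also have "\<dots> = r * m (Suc k # ys)"
    by (simp only: head pair extraction loop[OF \<open>subseq ys xs\<close>])
  finally show "((\<lambda>xs. r * K (Suc k # xs)) \<star> m) ys = (?rhs \<star> m) ys"
    by (simp only: list_convolution_mult_left head)
qed

section \<open>Limits of solutions of loop equations\<close>

lemma subseq_sum_list_le: "subseq ys xs \<Longrightarrow> sum_list ys \<le> sum_list xs" for xs :: "nat list"
  by (induction rule: list_emb.induct) auto

lemma of_nat_list_convolution:
  "of_nat ((f \<star> g) xs) = ((\<lambda>ys. of_nat (f ys)) \<star> (\<lambda>ys. of_nat (g ys))) xs"
  by (simp add: list_convolution_def)

lemma tendsto_list_convolution:
  fixes f g :: "'n \<Rightarrow> 'a list \<Rightarrow> real"
  assumes "\<And>ys. subseq ys xs \<Longrightarrow> ((\<lambda>n. f n ys) \<longlongrightarrow> f' ys) F"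
    and "\<And>ys. subseq ys xs \<Longrightarrow> ((\<lambda>n. g n ys) \<longlongrightarrow> g' ys) F"
  shows "((\<lambda>n. (f n \<star> g n) xs) \<longlongrightarrow> (f' \<star> g') xs) F"
  unfolding list_convolution_def
  by (intro tendsto_sum tendsto_mult assms) (auto simp: subseq_conv_nths)

lemma sum_extract_in_smallo:
  fixes f :: "'a \<Rightarrow> 'a list \<Rightarrow> 'n \<Rightarrow> real"
  assumes "\<And>y ys. add_mset y (mset ys) = mset xs \<Longrightarrow> f y ys \<in> o[F](g)"
  shows "(\<lambda>n. sum_extract (\<lambda>y ys. f y ys n) xs) \<in> o[F](g)"
  unfolding sum_extract_def by (intro big_sum_in_smallo assms mset_nth_nths) simp

lemma const_bigo_one_plus_sum: "(\<lambda>_. 1) \<in> O[F](\<lambda>n. 1 + (\<Sum>x\<in>X. \<bar>u x n\<bar> :: real))"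
  by (intro bigoI[of _ 1] always_eventually) (simp add: sum_nonneg)

lemma bigo_one_plus_sum:
  fixes u :: "'x \<Rightarrow> 'n \<Rightarrow> real"
  assumes "finite X" "x \<in> X"
  shows "u x \<in> O[F](\<lambda>n. 1 + (\<Sum>x\<in>X. \<bar>u x n\<bar>))"
proof (intro bigoI[of _ 1] always_eventually allI)
  fix n
  have "\<bar>u x n\<bar> \<le> (\<Sum>x\<in>X. \<bar>u x n\<bar>)"
    using assms by (intro member_le_sum) auto
  then show "norm (u x n) \<le> 1 * norm (1 + (\<Sum>x\<in>X. \<bar>u x n\<bar>))"
    unfolding real_norm_def mult_1 by linarith
qed

lemma diff_smallo_of_tendsto:
  fixes f :: "'n \<Rightarrow> real"
  assumes "(f \<longlongrightarrow> l) F" "(\<lambda>_. 1) \<in> O[F](g)"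
  shows "(\<lambda>n. f n - l) \<in> o[F](g)"
proof -
  have "(\<lambda>n. f n - l) \<in> o[F](\<lambda>_. 1)"
    using assms(1) by (intro smalloI_tendsto) (simp_all add: LIM_zero)
  then show ?thesis
    using assms(2) by (rule landau_o.small_big_trans)
qed

lemma mult_smallo_of_tendsto_0:
  fixes e f :: "'n \<Rightarrow> real"
  assumes "(e \<longlongrightarrow> 0) F" "f \<in> O[F](g)"
  shows "(\<lambda>n. e n * f n) \<in> o[F](g)"
  using landau_o.small_big_mult[of e F "\<lambda>_. 1" f g] diff_smallo_of_tendsto[OF assms(1), of "\<lambda>_. 1"]
    assms(2)
  by simp

lemma tendsto_of_smallo_one_plus_sum:
  fixes u :: "'x \<Rightarrow> 'n \<Rightarrow> real"
  assumes small: "\<And>x. x \<in> X \<Longrightarrow> (\<lambda>n. u x n - l x) \<in> o[F](\<lambda>n. 1 + (\<Sum>x\<in>X. \<bar>u x n\<bar>))"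
    and "x \<in> X"
  shows "(u x \<longlongrightarrow> l x) F"
proof -
  define M where "M n = 1 + (\<Sum>x\<in>X. \<bar>u x n\<bar>)" for n
  have M: "M n > 0" for n
    by (simp add: M_def add_pos_nonneg sum_nonneg)
  have "(\<lambda>n. \<Sum>x\<in>X. \<bar>u x n - l x\<bar>) \<in> o[F](M)"
    using small by (intro big_sum_in_smallo) (simp add: M_def[abs_def])
  then have "\<forall>\<^sub>F n in F. norm (\<Sum>x\<in>X. \<bar>u x n - l x\<bar>) \<le> 1 / 2 * norm (M n)"
    by (rule landau_o.smallD) simp
  then have "\<forall>\<^sub>F n in F. norm (M n) \<le> 2 * (1 + (\<Sum>x\<in>X. \<bar>l x\<bar>)) * norm (1::real)"
  proof eventually_elim
    case (elim n)
    have "(\<Sum>x\<in>X. \<bar>u x n\<bar>) \<le> (\<Sum>x\<in>X. \<bar>l x\<bar> + \<bar>u x n - l x\<bar>)"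
      by (intro sum_mono) linarith
    then show ?case
      using elim M[of n] by (simp add: M_def sum.distrib)
  qed
  then have "M \<in> O[F](\<lambda>_. 1)"
    by (rule bigoI)
  then have "(\<lambda>n. u x n - l x) \<in> o[F](\<lambda>_. 1)"
    using small[OF \<open>x \<in> X\<close>] landau_o.small_big_trans by (auto simp: M_def[abs_def])
  from smalloD_tendsto[OF this] have "((\<lambda>n. u x n - l x) \<longlongrightarrow> 0) F"
    by simp
  then show ?thesis
    by (rule LIM_zero_cancel)
qed

text \<open>Zero entries are counted separately because they do not contribute to the sum.\<close>
definition lists_of_sum :: "nat \<Rightarrow> nat \<Rightarrow> nat list set" where
  "lists_of_sum d z = {xs. sum_list xs = d \<and> count_list xs 0 \<le> z}"

lemma finite_lists_of_sum: "finite (lists_of_sum d z)"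
proof (rule finite_subset)
  have "length xs \<le> sum_list xs + count_list xs 0" for xs :: "nat list"
    by (induction xs) auto
  moreover have "x \<le> sum_list xs" if "x \<in> set xs" for x and xs :: "nat list"
    using that by (simp add: member_le_sum_list)
  ultimately have "set xs \<subseteq> {..d} \<and> length xs \<le> d + z" if "xs \<in> lists_of_sum d z" for xs
    using that unfolding lists_of_sum_def by (fastforce intro: order_trans)
  then show "lists_of_sum d z \<subseteq> {xs. set xs \<subseteq> {..d} \<and> length xs \<le> d + z}"
    by blast
qed (rule finite_lists_length_le, simp)

function loop_limit :: "nat list \<Rightarrow> nat" where
  "loop_limit [] = 0"
| "loop_limit (0 # xs) = of_bool (xs = [])"
| "loop_limit (Suc k # xs) = loop_limit (k # xs)
     + (\<Sum>a<k. ((\<lambda>ys. loop_limit (Suc a # ys)) \<star> (\<lambda>ys. loop_limit ((k - a) # ys))) xs)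
     + 2 * sum_extract (\<lambda>j js. j * loop_limit ((j + k + 1) # js)) xs"
  by pat_completeness auto

lemma mset_Cons_eqD:
  fixes xs :: "nat list"
  assumes "add_mset y (mset ys) = mset xs"
  shows "sum_list xs = y + sum_list ys" "length xs = Suc (length ys)"
    "count_list ys z \<le> count_list xs z"
proof -
  have "sum_mset (mset xs) = y + sum_mset (mset ys)"
    by (simp only: sum_mset.add_mset flip: assms)
  then show "sum_list xs = y + sum_list ys"
    by (simp only: sum_mset_sum_list)
  show "length xs = Suc (length ys)"
    using assms by (metis size_add_mset size_mset)
  show "count_list ys z \<le> count_list xs z"
    by (simp flip: count_mset assms)
qed

termination loop_limit
  by (relation "measures [sum_list, length]")
    (auto dest: subseq_sum_list_le mset_Cons_eqD)

declare loop_limit.simps(3) [simp del]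

locale loop_equations =
  fixes c :: "nat \<Rightarrow> nat list \<Rightarrow> real" and r :: "nat \<Rightarrow> nat \<Rightarrow> real" and \<epsilon> :: "nat \<Rightarrow> real"
  assumes r_tendsto: "(\<lambda>N. r N k) \<longlonglongrightarrow> 1"
    and \<epsilon>_tendsto: "\<epsilon> \<longlonglongrightarrow> 0"
    and zero_tendsto: "(\<lambda>N. c N (0 # xs)) \<longlonglongrightarrow> of_bool (xs = [])"
    and loop: "\<forall>\<^sub>F N in sequentially. r N k * c N (Suc k # xs) = c N (k # xs)
       + (\<Sum>a<k. \<epsilon> N * c N (Suc a # (k - a) # xs)
           + ((\<lambda>ys. c N (Suc a # ys)) \<star> (\<lambda>ys. c N ((k - a) # ys))) xs)
       + 2 * sum_extract (\<lambda>j js. real j * c N ((j + k + 1) # js)) xs"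
begin

lemma eventually_diff_loop_limit_eq:
  defines "L ys \<equiv> real (loop_limit ys)"
  shows "\<forall>\<^sub>F N in sequentially. c N (Suc k # xs) - L (Suc k # xs) =
      (1 - r N k) * c N (Suc k # xs) + (c N (k # xs) - L (k # xs))
      + (\<Sum>a<k. \<epsilon> N * c N (Suc a # (k - a) # xs)
          + (((\<lambda>ys. c N (Suc a # ys)) \<star> (\<lambda>ys. c N ((k - a) # ys))) xs
             - ((\<lambda>ys. L (Suc a # ys)) \<star> (\<lambda>ys. L ((k - a) # ys))) xs))
      + 2 * sum_extract (\<lambda>j js. real j * (c N ((j + k + 1) # js) - L ((j + k + 1) # js))) xs"
  using loop[of k xs]
proof eventually_elim
  case (elim N)
  have limit: "L (Suc k # xs) = L (k # xs) + (\<Sum>a<k. ((\<lambda>ys. L (Suc a # ys)) \<star> (\<lambda>ys. L ((k - a) # ys))) xs)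
      + 2 * sum_extract (\<lambda>j js. real j * L ((j + k + 1) # js)) xs"
    unfolding L_def loop_limit.simps(3)[of k xs]
    by (simp add: of_nat_list_convolution sum_extract_def)
  have "c N (Suc k # xs) - L (Suc k # xs)
      = (1 - r N k) * c N (Suc k # xs) + r N k * c N (Suc k # xs) - L (Suc k # xs)"
    by (simp add: left_diff_distrib)
  then show ?case
    unfolding elim limit
    by (simp add: sum.distrib sum_subtractf sum_extract_def right_diff_distrib)
qed

text \<open>
  In degree \<open>d\<close> the equations form a finite system whose coupling to longer lists carries a vanishing
  factor. Errors are therefore measured relative to one plus the sum of all unknowns of the system,
  which turns out to be bounded.
\<close>
lemma diff_loop_limit_Suc_smallo:
  defines "M d z \<equiv> \<lambda>N. 1 + (\<Sum>ys\<in>lists_of_sum d z. \<bar>c N ys\<bar>)"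
  assumes lower: "\<And>ys. ys \<noteq> [] \<Longrightarrow> sum_list ys < d \<Longrightarrow> (\<lambda>N. c N ys) \<longlonglongrightarrow> real (loop_limit ys)"
    and shorter: "\<And>ys. length ys < length (Suc k # xs) \<Longrightarrow> ys \<in> lists_of_sum d z \<Longrightarrow> ys \<noteq> [] \<Longrightarrow>
      (\<lambda>N. c N ys - real (loop_limit ys)) \<in> o(M d z)"
    and mem: "Suc k # xs \<in> lists_of_sum d z"
  shows "(\<lambda>N. c N (Suc k # xs) - real (loop_limit (Suc k # xs))) \<in> o(M d z)"
proof (subst landau_o.small.in_cong[OF eventually_diff_loop_limit_eq],
    intro sum_in_smallo(1) big_sum_in_smallo cmult_in_smallo_iff[THEN iffD2, OF disjI2]
        sum_extract_in_smallo)
  have degree: "Suc k + sum_list xs = d"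
    using mem by (simp add: lists_of_sum_def)
  have bigo: "(\<lambda>N. c N ys) \<in> O(M d z)" if "ys \<in> lists_of_sum d z" for ys
    unfolding M_def using finite_lists_of_sum that by (rule bigo_one_plus_sum)
  have smallo: "(\<lambda>N. f N - l) \<in> o(M d z)" if "f \<longlonglongrightarrow> l" for f and l :: real
    unfolding M_def using that const_bigo_one_plus_sum by (rule diff_smallo_of_tendsto)
  show "(\<lambda>N. (1 - r N k) * c N (Suc k # xs)) \<in> o(M d z)"
    using tendsto_diff[OF tendsto_const r_tendsto[of k], of 1] mem
    by (intro mult_smallo_of_tendsto_0 bigo) simp_all
  show "(\<lambda>N. c N (k # xs) - real (loop_limit (k # xs))) \<in> o(M d z)"
    using degree by (intro smallo lower) simp_all
  show "(\<lambda>N. \<epsilon> N * c N (Suc a # (k - a) # xs)) \<in> o(M d z)" if "a \<in> {..<k}" for a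
    using that mem by (intro mult_smallo_of_tendsto_0 \<epsilon>_tendsto bigo) (auto simp: lists_of_sum_def)
  show "(\<lambda>N. ((\<lambda>ys. c N (Suc a # ys)) \<star> (\<lambda>ys. c N ((k - a) # ys))) xs
      - ((\<lambda>ys. real (loop_limit (Suc a # ys))) \<star> (\<lambda>ys. real (loop_limit ((k - a) # ys)))) xs) \<in> o(M d z)"
    if "a \<in> {..<k}" for a
    using that degree by (intro smallo tendsto_list_convolution lower) (auto dest: subseq_sum_list_le)
  show "(\<lambda>N. c N ((j + k + 1) # js) - real (loop_limit ((j + k + 1) # js))) \<in> o(M d z)"
    if "add_mset j (mset js) = mset xs" for j js
    using mset_Cons_eqD(1,2)[OF that] mset_Cons_eqD(3)[OF that, of 0] mem
    by (intro shorter) (auto simp: lists_of_sum_def)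
qed

lemma diff_loop_limit_smallo:
  assumes lower: "\<And>ys. ys \<noteq> [] \<Longrightarrow> sum_list ys < d \<Longrightarrow> (\<lambda>N. c N ys) \<longlonglongrightarrow> real (loop_limit ys)"
    and "xs \<in> lists_of_sum d z" "xs \<noteq> []"
  shows "(\<lambda>N. c N xs - real (loop_limit xs)) \<in> o(\<lambda>N. 1 + (\<Sum>ys\<in>lists_of_sum d z. \<bar>c N ys\<bar>))"
  using assms(2,3)
proof (induction "length xs" arbitrary: xs rule: less_induct)
  case less
  show ?case
  proof (cases xs rule: loop_limit.cases)
    case 1
    then show ?thesis using less.prems by simp
  next
    case (2 ys)
    then show ?thesis
      using zero_tendsto[of ys] by (intro diff_smallo_of_tendsto const_bigo_one_plus_sum) simp
  next
    case (3 k ys)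
    show ?thesis
      using less.prems(1) unfolding 3
      by (intro diff_loop_limit_Suc_smallo lower less.hyps) (simp_all add: 3)
  qed
qed

theorem tendsto_loop_limit:
  assumes "xs \<noteq> []"
  shows "(\<lambda>N. c N xs) \<longlonglongrightarrow> real (loop_limit xs)"
  using assms
proof (induction "sum_list xs" arbitrary: xs rule: less_induct)
  case less
  show ?case
  proof (cases "sum_list xs = 0")
    case True
    then obtain ys where "xs = 0 # ys"
      using less.prems by (cases xs) auto
    then show ?thesis
      using zero_tendsto[of ys] by simp
  next
    case False
    define z where "z = count_list xs 0"
    have "(\<lambda>N. c N ys - real (loop_limit ys)) \<in> o(\<lambda>N. 1 + (\<Sum>ys\<in>lists_of_sum (sum_list xs) z. \<bar>c N ys\<bar>))"
      if "ys \<in> lists_of_sum (sum_list xs) z" for ys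
      using that False less.hyps by (intro diff_loop_limit_smallo) (auto simp: lists_of_sum_def)
    then show ?thesis
      by (rule tendsto_of_smallo_one_plus_sum[
            where X = "lists_of_sum (sum_list xs) z" and u = "\<lambda>ys N. c N ys"])
        (simp_all add: lists_of_sum_def z_def)
  qed
qed

end

section \<open>Integration on the positive half line\<close>

lemma interval_integral_FTC_strong:
  fixes f F :: "real \<Rightarrow> 'a::euclidean_space" and a b :: real
  assumes "a \<le> b" "finite E" "continuous_on {a..b} F"
    and "\<And>x. x \<in> {a..b} - E \<Longrightarrow> (F has_vector_derivative f x) (at x)"
    and "set_integrable lborel {a..b} f"
  shows "(LBINT x=a..b. f x) = F b - F a"
proof -
  have "(f has_integral F b - F a) {a..b}"
    using assms(1-4) by (intro fundamental_theorem_of_calculus_strong[of E]) auto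
  then show ?thesis
    using assms(1,5)
      by (simp add: interval_integral_Icc set_borel_integral_eq_integral(2) integral_unique)
qed

lemma interval_integral_FTC_integrable_strong:
  fixes f F :: "real \<Rightarrow> 'a::euclidean_space" and a b :: ereal
  assumes "a < b" "finite E"
    and F: "\<And>x. a < ereal x \<Longrightarrow> ereal x < b \<Longrightarrow> x \<notin> E \<Longrightarrow> (F has_vector_derivative f x) (at x)"
    and cont: "continuous_on (einterval a b) F"
    and f_integrable: "set_integrable lborel (einterval a b) f"
    and A: "((F \<circ> real_of_ereal) \<longlongrightarrow> A) (at_right a)"
    and B: "((F \<circ> real_of_ereal) \<longlongrightarrow> B) (at_left b)"
  shows "(LBINT x=a..b. f x) = B - A"
proof -
  obtain u l where approx:
    "einterval a b = (\<Union>i. {l i .. u i})"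
    "incseq u" "decseq l" "\<And>i. l i < u i" "\<And>i. a < l i" "\<And>i. u i < b"
    "l \<longlonglongrightarrow> a" "u \<longlonglongrightarrow> b"
    by (blast intro: einterval_Icc_approximation[OF \<open>a < b\<close>])
  have sub: "{l i .. u i} \<subseteq> einterval a b" for i
    using approx(1) by blast
  have FTC: "(LBINT x=l i..u i. f x) = F (u i) - F (l i)" for i
    using approx(4)[of i] sub[of i] \<open>finite E\<close>
    by (intro interval_integral_FTC_strong[of _ _ E] continuous_on_subset[OF cont] F
        set_integrable_subset[OF f_integrable]) (auto simp: einterval_iff)
  have "(\<lambda>i. LBINT x=l i..u i. f x) \<longlonglongrightarrow> B - A"
    unfolding FTC
  proof (rule tendsto_diff)
    show "(\<lambda>i. F (l i)) \<longlonglongrightarrow> A"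
      using A approx unfolding tendsto_at_iff_sequentially comp_def
      by (elim allE[of _ "\<lambda>i. ereal (l i)"], auto)
    show "(\<lambda>i. F (u i)) \<longlonglongrightarrow> B"
      using B approx unfolding tendsto_at_iff_sequentially comp_def
      by (elim allE[of _ "\<lambda>i. ereal (u i)"], auto)
  qed
  moreover have "(\<lambda>i. LBINT x=l i..u i. f x) \<longlonglongrightarrow> (LBINT x=a..b. f x)"
    by (rule interval_integral_Icc_approx_integrable[OF \<open>a < b\<close> approx f_integrable])
  ultimately show ?thesis
    by (rule LIMSEQ_unique[rotated])
qed

lemma integral_derivative_half_line:
  fixes f f' :: "real \<Rightarrow> real"
  assumes "finite E"
    and deriv: "\<And>y. y > 0 \<Longrightarrow> y \<notin> E \<Longrightarrow> (f has_real_derivative f' y) (at y)"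
    and cont: "continuous_on {0<..} f"
    and vanish: "\<And>y. y \<le> 0 \<Longrightarrow> f' y = 0"
    and f'_integrable: "integrable lborel f'"
    and limits: "(f \<longlongrightarrow> A) (at_right 0)" "(f \<longlongrightarrow> B) at_top"
  shows "(\<integral>y. f' y \<partial>lborel) = B - A"
proof -
  have half_line: "einterval 0 \<infinity> = {0<..}"
    by (auto simp: einterval_iff)
  have "(\<integral>y. f' y \<partial>lborel) = (LBINT y:{0<..}. f' y)"
    unfolding set_lebesgue_integral_def
    by (rule Bochner_Integration.integral_cong) (auto simp: vanish indicator_def)
  also have "\<dots> = (LBINT y=0..\<infinity>. f' y)"
    by (simp add: interval_lebesgue_integral_def half_line)
  also have "\<dots> = B - A"
  proof (rule interval_integral_FTC_integrable_strong[OF _ \<open>finite E\<close>])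
    show "((f \<circ> real_of_ereal) \<longlongrightarrow> A) (at_right 0)" "((f \<circ> real_of_ereal) \<longlongrightarrow> B) (at_left \<infinity>)"
      using limits by (simp_all add: zero_ereal_def ereal_tendsto_simps)
    show "set_integrable lborel (einterval 0 \<infinity>) f'"
      unfolding set_integrable_def half_line
      using f'_integrable by (intro integrable_mult_indicator) auto
  qed (use deriv cont in \<open>auto simp: half_line simp flip: has_real_derivative_iff_has_vector_derivative\<close>)
  finally show ?thesis .
qed

definition gamma_envelope :: "real \<Rightarrow> real \<Rightarrow> real" where
  "gamma_envelope c y = (if y > 0 then y * exp (- c * y) else 0)"

lemma gamma_envelope_nonneg: "gamma_envelope c y \<ge> 0"
  by (simp add: gamma_envelope_def)

lemma gamma_envelope_at_top:
  assumes "c > 0"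
  shows "(gamma_envelope c \<longlongrightarrow> 0) at_top"
proof (rule Lim_transform_eventually)
  show "((\<lambda>y. y * exp (- c * y)) \<longlongrightarrow> 0) at_top"
    using assms by real_asymp
  show "\<forall>\<^sub>F y in at_top. y * exp (- c * y) = gamma_envelope c y"
    using eventually_gt_at_top[of 0] by eventually_elim (simp add: gamma_envelope_def)
qed

lemma gamma_envelope_at_right_0: "(gamma_envelope c \<longlongrightarrow> 0) (at_right 0)"
proof (rule Lim_transform_eventually)
  show "((\<lambda>y. y * exp (- c * y)) \<longlongrightarrow> 0) (at_right 0)"
    by real_asymp
  show "\<forall>\<^sub>F y in at_right 0. y * exp (- c * y) = gamma_envelope c y"
    using eventually_at_right_less[of 0] by eventually_elim (simp add: gamma_envelope_def)
qed

lemma integrable_gamma_envelope: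
  assumes "c > 0"
  shows "integrable lborel (gamma_envelope c)"
proof -
  define h where "h t = complex_of_real t powr (2 - 1) / of_real (exp (c * t))" for t
  have "h absolutely_integrable_on {0<..}"
    unfolding h_def using assms by (intro absolutely_integrable_Gamma_integral) auto
  then have "integrable lebesgue (\<lambda>t. norm (indicator {0<..} t *\<^sub>R h t))"
    unfolding set_integrable_def by (rule integrable_norm)
  also have "(\<lambda>t. norm (indicator {0<..} t *\<^sub>R h t)) = gamma_envelope c"
    by (auto simp: h_def gamma_envelope_def norm_divide exp_minus field_simps)
  finally show ?thesis
    by (subst (asm) integrable_completion) (auto simp: gamma_envelope_def[abs_def])
qed

lemma power_one_plus_le_exp:
  fixes \<delta> :: real
  assumes "\<delta> > 0"
  shows "\<exists>K\<ge>0. \<forall>y\<ge>0. (1 + y) ^ m \<le> K * exp (\<delta> * y)"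
proof -
  define \<eta> where "\<eta> = \<delta> / real (Suc m)"
  have \<eta>: "\<eta> > 0" "real m * \<eta> \<le> \<delta>"
    using assms by (simp_all add: \<eta>_def field_simps)
  have "(1 + y) ^ m \<le> (1 + 1 / \<eta>) ^ m * exp (\<delta> * y)" if "y \<ge> 0" for y
  proof -
    have "1 + y \<le> (1 + 1 / \<eta>) * (1 + \<eta> * y)"
      using \<eta>(1) that by (simp add: field_simps)
    also have "\<dots> \<le> (1 + 1 / \<eta>) * exp (\<eta> * y)"
      using \<eta>(1) by (intro mult_left_mono exp_ge_add_one_self) simp
    finally have "(1 + y) ^ m \<le> (1 + 1 / \<eta>) ^ m * exp (real m * (\<eta> * y))"
      using that by (simp add: power_mono exp_of_nat_mult flip: power_mult_distrib)
    also have "\<dots> \<le> (1 + 1 / \<eta>) ^ m * exp (\<delta> * y)"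
      using \<eta> that mult_right_mono[OF \<eta>(2) that] by (intro mult_left_mono) (simp_all add: mult.assoc)
    finally show ?thesis .
  qed
  then show ?thesis
    using \<eta>(1) by (intro exI[of _ "(1 + 1 / \<eta>) ^ m"]) simp
qed

lemma powr_le_power_ceiling:
  fixes t P :: real
  assumes "0 \<le> t" "t \<le> P" "1 \<le> P" "0 \<le> a" "a \<le> b"
  shows "t powr a \<le> P ^ nat \<lceil>b\<rceil>"
proof -
  have "t powr a \<le> P powr a"
    using assms by (intro powr_mono2) auto
  also have "\<dots> \<le> P powr real (nat \<lceil>b\<rceil>)"
    using assms by (intro powr_mono) linarith+
  also have "\<dots> = P ^ nat \<lceil>b\<rceil>"
    by (rule powr_realpow) (use assms in linarith)
  finally show ?thesis .
qed

lemma laguerre_factor_le_gamma_envelope: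
  fixes a c :: real
  assumes "real D + 1 \<le> a" "c > 0"
  shows "\<exists>K\<ge>0. \<forall>y>0. (1 + 1 / y) ^ D * (1 + y) ^ Q * (y powr a * exp (- c * y))
      \<le> K * gamma_envelope (c / 2) y"
proof -
  obtain K where K: "K \<ge> 0" "\<And>y. y \<ge> 0 \<Longrightarrow> (1 + y) ^ (D + Q + nat \<lceil>a\<rceil>) \<le> K * exp (c / 2 * y)"
    using power_one_plus_le_exp[of "c / 2"] assms(2) by (metis half_gt_zero)
  have "(1 + 1 / y) ^ D * (1 + y) ^ Q * (y powr a * exp (- c * y)) \<le> K * gamma_envelope (c / 2) y"
    if "y > 0" for y
  proof -
    have powr_split: "y powr a = y ^ D * (y * y powr (a - D - 1))"
      using that by (simp add: powr_diff powr_realpow[symmetric])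
    have absorb: "(1 + 1 / y) ^ D * y ^ D = (1 + y) ^ D"
      using that by (simp add: power_mult_distrib[symmetric] field_simps)
    have "(1 + 1 / y) ^ D * (1 + y) ^ Q * (y powr a * exp (- c * y))
        = y * exp (- c * y) * ((1 + 1 / y) ^ D * y ^ D * (1 + y) ^ Q * y powr (a - D - 1))"
      by (simp only: powr_split mult_ac)
    also have "\<dots> = y * exp (- c * y) * ((1 + y) ^ (D + Q) * y powr (a - D - 1))"
      by (simp only: absorb power_add)
    also have "\<dots> \<le> y * exp (- c * y) * ((1 + y) ^ (D + Q) * (1 + y) ^ nat \<lceil>a\<rceil>)"
      using that assms by (intro mult_left_mono powr_le_power_ceiling) auto
    also have "\<dots> \<le> y * exp (- c * y) * (K * exp (c / 2 * y))"
      using that K(2)[of y] by (intro mult_left_mono) (simp_all add: power_add)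
    also have "\<dots> = K * (y * (exp (- c * y) * exp (c / 2 * y)))"
      by (simp only: mult_ac)
    also have "exp (- c * y) * exp (c / 2 * y) = exp (- (c / 2) * y)"
      by (simp flip: exp_add)
    finally show ?thesis
      using that by (simp add: gamma_envelope_def)
  qed
  then show ?thesis using K(1) by blast
qed

section \<open>Laguerre weights\<close>

definition orthant :: "nat \<Rightarrow> (nat \<Rightarrow> real) set" where
  "orthant N = {x. \<forall>k<N. x k > 0}"

definition index_pairs :: "nat \<Rightarrow> (nat \<times> nat) set" where
  "index_pairs N = (SIGMA i:{..<N}. {i<..<N})"

text \<open>
  Every pair of coordinates has its own exponent, so that the family of weights is closed under
  division by the modulus of a difference of coordinates.
\<close>
definition vandermonde_powr :: "(nat \<times> nat \<Rightarrow> real) \<Rightarrow> nat \<Rightarrow> (nat \<Rightarrow> real) \<Rightarrow> real" where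
  "vandermonde_powr \<gamma> N x = (\<Prod>(i, j)\<in>index_pairs N. \<bar>x i - x j\<bar> powr \<gamma> (i, j))"

definition laguerre_density :: "(nat \<times> nat \<Rightarrow> real) \<Rightarrow> real \<Rightarrow> real \<Rightarrow> nat \<Rightarrow> (nat \<Rightarrow> real) \<Rightarrow> real" where
  "laguerre_density \<gamma> a c N x = vandermonde_powr \<gamma> N x * (\<Prod>k<N. x k powr a * exp (- c * x k))"

definition laguerre_weight :: "(nat \<times> nat \<Rightarrow> real) \<Rightarrow> real \<Rightarrow> real \<Rightarrow> nat \<Rightarrow> (nat \<Rightarrow> real) \<Rightarrow> real" where
  "laguerre_weight \<gamma> a c N x = indicator (orthant N) x * laguerre_density \<gamma> a c N x"

lemma index_pairs_iff: "(i, j) \<in> index_pairs N \<longleftrightarrow> i < j \<and> j < N"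
  by (auto simp: index_pairs_def)

lemma finite_index_pairs: "finite (index_pairs N)"
  by (simp add: index_pairs_def)

lemma ws_weight_eq_laguerre_weight:
  "ws_weight \<beta> N = laguerre_weight (\<lambda>_. \<beta>) (\<beta> * real N / 2) (\<beta> * real N / 2) N"
proof
  fix x
  have "(\<Prod>i<N. \<Prod>j\<in>{i<..<N}. \<bar>x i - x j\<bar> powr \<beta>) = vandermonde_powr (\<lambda>_. \<beta>) N x"
    unfolding vandermonde_powr_def index_pairs_def by (rule prod.Sigma) auto
  then show "ws_weight \<beta> N x = laguerre_weight (\<lambda>_. \<beta>) (\<beta> * real N / 2) (\<beta> * real N / 2) N x"
    by (simp add: ws_weight_def laguerre_weight_def laguerre_density_def orthant_def)
qed

lemma vandermonde_powr_nonneg: "vandermonde_powr \<gamma> N x \<ge> 0"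
  unfolding vandermonde_powr_def by (intro prod_nonneg) auto

lemma laguerre_density_nonneg: "laguerre_density \<gamma> a c N x \<ge> 0"
  unfolding laguerre_density_def by (intro mult_nonneg_nonneg vandermonde_powr_nonneg prod_nonneg) auto

lemma laguerre_weight_nonneg: "laguerre_weight \<gamma> a c N x \<ge> 0"
  by (simp add: laguerre_weight_def laguerre_density_nonneg)

lemma laguerre_weight_eq_0_outside: "x \<notin> orthant N \<Longrightarrow> laguerre_weight \<gamma> a c N x = 0"
  by (simp add: laguerre_weight_def)

lemma laguerre_weight_neq_0_iff:
  "laguerre_weight \<gamma> a c N x \<noteq> 0 \<longleftrightarrow> x \<in> orthant N \<and> inj_on x {..<N}"
proof -
  have "vandermonde_powr \<gamma> N x \<noteq> 0 \<longleftrightarrow> (\<forall>p\<in>index_pairs N. x (fst p) \<noteq> x (snd p))"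
    by (simp add: vandermonde_powr_def finite_index_pairs prod_zero_iff case_prod_unfold)
  also have "\<dots> \<longleftrightarrow> (\<forall>i j. i < j \<longrightarrow> j < N \<longrightarrow> x i \<noteq> x j)"
    by (auto simp: index_pairs_def)
  also have "\<dots> \<longleftrightarrow> inj_on x {..<N}"
    by (auto simp: inj_on_def) (metis nat_neq_iff)
  finally have "vandermonde_powr \<gamma> N x \<noteq> 0 \<longleftrightarrow> inj_on x {..<N}" .
  moreover have "(\<Prod>k<N. x k powr a * exp (- c * x k)) \<noteq> 0" if "x \<in> orthant N"
    using that by (force simp: orthant_def prod_zero_iff)
  ultimately show ?thesis
    by (auto simp: laguerre_weight_def laguerre_density_def indicator_def)
qed

lemma measurable_ws_component: "i < N \<Longrightarrow> (\<lambda>x. x i) \<in> borel_measurable (ws_space N)"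
  using measurable_component_singleton[of i "{..<N}" "\<lambda>_. lborel :: real measure"]
  by (simp add: ws_space_def)

lemma measurable_laguerre_weight: "laguerre_weight \<gamma> a c N \<in> borel_measurable (ws_space N)"
proof -
  have "{x \<in> space (ws_space N). \<forall>k\<in>{..<N}. 0 < x k} \<in> sets (ws_space N)"
    by (intro sets.sets_Collect_finite_All borel_measurable_less borel_measurable_const
        measurable_ws_component) auto
  also have "{x \<in> space (ws_space N). \<forall>k\<in>{..<N}. 0 < x k} = orthant N \<inter> space (ws_space N)"
    by (auto simp: orthant_def)
  finally have "(indicator (orthant N) :: _ \<Rightarrow> real) \<in> borel_measurable (ws_space N)"
    by (simp only: borel_measurable_indicator_iff)
  moreover have "vandermonde_powr \<gamma> N \<in> borel_measurable (ws_space N)"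
    unfolding vandermonde_powr_def
  proof (rule borel_measurable_prod)
    fix p assume "p \<in> index_pairs N"
    then obtain i j where p: "p = (i, j)" and "i < N" "j < N"
      by (auto simp: index_pairs_def)
    then have [measurable]: "(\<lambda>x. x i) \<in> borel_measurable (ws_space N)"
      "(\<lambda>x. x j) \<in> borel_measurable (ws_space N)"
      by (simp_all add: measurable_ws_component)
    show "(\<lambda>x. case p of (i, j) \<Rightarrow> \<bar>x i - x j\<bar> powr \<gamma> (i, j)) \<in> borel_measurable (ws_space N)"
      unfolding p by simp
  qed
  moreover have "(\<lambda>x. \<Prod>k<N. x k powr a * exp (- c * x k)) \<in> borel_measurable (ws_space N)"
  proof (rule borel_measurable_prod)
    fix k assume "k \<in> {..<N}"
    then have [measurable]: "(\<lambda>x. x k) \<in> borel_measurable (ws_space N)"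
      by (simp add: measurable_ws_component)
    show "(\<lambda>x. x k powr a * exp (- c * x k)) \<in> borel_measurable (ws_space N)"
      by measurable
  qed
  ultimately show ?thesis
    unfolding laguerre_weight_def[abs_def] laguerre_density_def by (intro borel_measurable_times)
qed

lemma member_le_prod:
  fixes f :: "'a \<Rightarrow> 'b::linordered_idom"
  assumes "finite A" "i \<in> A" "\<And>j. j \<in> A \<Longrightarrow> 1 \<le> f j"
  shows "f i \<le> prod f A"
proof -
  have "f i * 1 \<le> f i * prod f (A - {i})"
    using assms by (intro mult_left_mono prod_ge_1) (auto intro: order_trans[OF zero_le_one])
  then show ?thesis
    using assms(1,2) by (simp add: prod.remove)
qed

lemma abs_diff_le_prod:
  assumes "x \<in> orthant N" "i < N" "j < N"
  shows "\<bar>x i - x j\<bar> \<le> (\<Prod>k<N. 1 + x k)"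
proof -
  have nonneg: "x k \<ge> 0" if "k < N" for k
    using assms(1) that by (simp add: orthant_def less_imp_le)
  have "1 + x k \<le> (\<Prod>k<N. 1 + x k)" if "k < N" for k
    using that nonneg by (intro member_le_prod) auto
  from this[OF assms(2)] this[OF assms(3)] show ?thesis
    using nonneg[OF assms(2)] nonneg[OF assms(3)] by (simp add: abs_if)
qed

lemma vandermonde_powr_le:
  assumes "\<And>p. 0 \<le> \<gamma> p \<and> \<gamma> p \<le> B" "x \<in> orthant N"
  shows "vandermonde_powr \<gamma> N x \<le> (\<Prod>k<N. 1 + x k) ^ (nat \<lceil>B\<rceil> * card (index_pairs N))"
proof -
  have ge_1: "1 \<le> (\<Prod>k<N. 1 + x k)"
    using assms(2) by (intro prod_ge_1) (auto simp: orthant_def intro: less_imp_le)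
  show ?thesis
    unfolding vandermonde_powr_def power_mult
  proof (rule prod_le_power)
    fix p assume "p \<in> index_pairs N"
    then obtain i j where p: "p = (i, j)" and "i < N" "j < N"
      by (auto simp: index_pairs_def)
    then have "\<bar>x i - x j\<bar> powr \<gamma> (i, j) \<le> (\<Prod>k<N. 1 + x k) ^ nat \<lceil>B\<rceil>"
      using assms ge_1 by (intro powr_le_power_ceiling abs_diff_le_prod) auto
    then show "0 \<le> (case p of (i, j) \<Rightarrow> \<bar>x i - x j\<bar> powr \<gamma> (i, j))
        \<and> (case p of (i, j) \<Rightarrow> \<bar>x i - x j\<bar> powr \<gamma> (i, j)) \<le> (\<Prod>k<N. 1 + x k) ^ nat \<lceil>B\<rceil>"
      by (simp add: p)
  qed (use ge_1 in \<open>auto intro: one_le_power\<close>)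
qed

lemma abs_laguerre_weight_divide:
  assumes "(i, j) \<in> index_pairs N"
  shows "\<bar>laguerre_weight \<gamma> a c N x / (x i - x j)\<bar> = laguerre_weight (\<gamma>((i, j) := \<gamma> (i, j) - 1)) a c N x"
proof -
  have powr: "\<bar>t\<bar> powr e / \<bar>t\<bar> = \<bar>t\<bar> powr (e - 1)" for t e :: real
    by (cases "t = 0") (simp_all add: powr_diff)
  have vandermonde: "vandermonde_powr (\<gamma>((i, j) := \<gamma> (i, j) - 1)) N x
      = vandermonde_powr \<gamma> N x / \<bar>x i - x j\<bar>"
  proof -
    have "(\<Prod>(k, l)\<in>index_pairs N - {(i, j)}. \<bar>x k - x l\<bar> powr (\<gamma>((i, j) := \<gamma> (i, j) - 1)) (k, l))
        = (\<Prod>(k, l)\<in>index_pairs N - {(i, j)}. \<bar>x k - x l\<bar> powr \<gamma> (k, l))"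
      by (rule prod.cong) (auto simp: case_prod_unfold prod_eq_iff)
    then show ?thesis
      by (simp add: vandermonde_powr_def prod.remove[OF finite_index_pairs assms] flip: powr)
  qed
  have "\<bar>laguerre_weight \<gamma> a c N x / (x i - x j)\<bar> = laguerre_weight \<gamma> a c N x / \<bar>x i - x j\<bar>"
    by (simp add: abs_divide laguerre_weight_nonneg)
  then show ?thesis
    by (simp add: laguerre_weight_def laguerre_density_def vandermonde)
qed

section \<open>Functions with poles on the coordinate hyperplanes\<close>

definition pole_order_le :: "nat \<Rightarrow> nat \<Rightarrow> ((nat \<Rightarrow> real) \<Rightarrow> real) \<Rightarrow> bool" where
  "pole_order_le N D G \<longleftrightarrow> G \<in> borel_measurable (ws_space N) \<and>
     G \<in> O[principal (orthant N)](\<lambda>x. (\<Prod>k<N. 1 + 1 / x k) ^ D)"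

lemma prod_one_plus_inverse_ge_1:
  assumes "x \<in> orthant N"
  shows "1 \<le> (\<Prod>k<N. 1 + 1 / x k)"
  using assms by (intro prod_ge_1) (auto simp: orthant_def intro: less_imp_le)

lemma pole_order_leE:
  assumes "pole_order_le N D G"
  obtains C where "C \<ge> 0" "\<And>x. x \<in> orthant N \<Longrightarrow> \<bar>G x\<bar> \<le> C * (\<Prod>k<N. 1 + 1 / x k) ^ D"
proof -
  obtain C where "C > 0" and C: "\<And>x. x \<in> orthant N \<Longrightarrow> norm (G x) \<le> C * norm ((\<Prod>k<N. 1 + 1 / x k) ^ D)"
    using assms unfolding pole_order_le_def by (auto elim!: landau_o.bigE simp: eventually_principal)
  have "\<bar>G x\<bar> \<le> C * (\<Prod>k<N. 1 + 1 / x k) ^ D" if "x \<in> orthant N" for x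
    using C[OF that] prod_one_plus_inverse_ge_1[OF that] by simp
  then show thesis
    using \<open>C > 0\<close> by (intro that[of C]) auto
qed

lemma pole_order_le_mono:
  assumes "pole_order_le N D G" "D \<le> D'"
  shows "pole_order_le N D' G"
proof -
  have "(\<lambda>_. 1) \<in> O[principal (orthant N)](\<lambda>x. \<Prod>k<N. 1 + 1 / x k)"
    using prod_one_plus_inverse_ge_1 by (intro bigoI[of _ 1]) (force simp: eventually_principal)
  then show ?thesis
    using assms landau_o.big_power_increasing landau_o.big_trans unfolding pole_order_le_def by blast
qed

lemma pole_order_le_const: "pole_order_le N 0 (\<lambda>_. a)"
  by (simp add: pole_order_le_def)

lemma pole_order_le_add:
  "pole_order_le N D G \<Longrightarrow> pole_order_le N D H \<Longrightarrow> pole_order_le N D (\<lambda>x. G x + H x)"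
  by (auto simp: pole_order_le_def sum_in_bigo)

lemma pole_order_le_mult:
  "pole_order_le N D G \<Longrightarrow> pole_order_le N E H \<Longrightarrow> pole_order_le N (D + E) (\<lambda>x. G x * H x)"
  by (auto simp: pole_order_le_def power_add landau_o.big_mult)

lemma pole_order_le_cmult: "pole_order_le N D G \<Longrightarrow> pole_order_le N D (\<lambda>x. a * G x)"
  using pole_order_le_mult[OF pole_order_le_const] by force

lemma pole_order_le_sum:
  "(\<And>i. i \<in> I \<Longrightarrow> pole_order_le N D (G i)) \<Longrightarrow> pole_order_le N D (\<lambda>x. \<Sum>i\<in>I. G i x)"
  by (simp add: pole_order_le_def big_sum_in_bigo borel_measurable_sum)

lemma pole_order_le_sum_extract:
  assumes "\<And>y ys. add_mset y (mset ys) = mset xs \<Longrightarrow> pole_order_le N D (G y ys)"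
  shows "pole_order_le N D (\<lambda>x. sum_extract (\<lambda>y ys. G y ys x) xs)"
  unfolding sum_extract_def by (intro pole_order_le_sum assms mset_nth_nths) simp

lemma pole_order_le_inverse_power:
  assumes "i < N"
  shows "pole_order_le N k (\<lambda>x. 1 / x i ^ k)"
proof -
  have "norm (1 / x i) \<le> 1 * norm (\<Prod>k<N. 1 + 1 / x k)" if "x \<in> orthant N" for x
  proof -
    have nonneg: "1 / x k \<ge> 0" if "k < N" for k
      using \<open>x \<in> orthant N\<close> that by (simp add: orthant_def less_imp_le)
    have "1 + 1 / x i \<le> (\<Prod>k<N. 1 + 1 / x k)"
      using assms nonneg by (intro member_le_prod) auto
    then show ?thesis
      using nonneg[OF assms] by simp
  qed
  then have "(\<lambda>x. 1 / x i) \<in> O[principal (orthant N)](\<lambda>x. \<Prod>k<N. 1 + 1 / x k)"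
    by (intro bigoI[of _ 1]) (simp add: eventually_principal)
  from landau_o.big_power[OF this, of k]
  have "(\<lambda>x. 1 / x i ^ k) \<in> O[principal (orthant N)](\<lambda>x. (\<Prod>k<N. 1 + 1 / x k) ^ k)"
    by (simp add: power_one_over)
  moreover have [measurable]: "(\<lambda>x. x i) \<in> borel_measurable (ws_space N)"
    using assms by (rule measurable_ws_component)
  ultimately show ?thesis
    by (simp add: pole_order_le_def)
qed

lemma pole_order_le_laguerre_weight_bound:
  assumes "pole_order_le N D G" "real D + 1 \<le> a" "c > 0" "\<And>p. 0 \<le> \<gamma> p \<and> \<gamma> p \<le> B"
  shows "\<exists>K\<ge>0. \<forall>x. \<bar>G x * laguerre_weight \<gamma> a c N x\<bar> \<le> K * (\<Prod>k<N. gamma_envelope (c / 2) (x k))"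
proof -
  obtain C where C: "C \<ge> 0" "\<And>x. x \<in> orthant N \<Longrightarrow> \<bar>G x\<bar> \<le> C * (\<Prod>k<N. 1 + 1 / x k) ^ D"
    using pole_order_leE[OF assms(1)] by blast
  define Q where "Q = nat \<lceil>B\<rceil> * card (index_pairs N)"
  obtain K where K: "K \<ge> 0" "\<And>y. y > 0 \<Longrightarrow>
      (1 + 1 / y) ^ D * (1 + y) ^ Q * (y powr a * exp (- c * y)) \<le> K * gamma_envelope (c / 2) y"
    using laguerre_factor_le_gamma_envelope[OF assms(2,3)] by blast
  have "\<bar>G x * laguerre_weight \<gamma> a c N x\<bar> \<le> C * K ^ N * (\<Prod>k<N. gamma_envelope (c / 2) (x k))" for x
  proof (cases "x \<in> orthant N")
    case False
    then show ?thesis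
      using C(1) K(1) by (simp add: laguerre_weight_eq_0_outside prod_nonneg gamma_envelope_nonneg)
  next
    case True
    then have pos: "x k > 0" if "k < N" for k
      using that by (simp add: orthant_def)
    have "\<bar>G x * laguerre_weight \<gamma> a c N x\<bar> = \<bar>G x\<bar> * laguerre_density \<gamma> a c N x"
      using True by (simp add: abs_mult laguerre_weight_def laguerre_density_nonneg)
    also have "\<dots> \<le> C * (\<Prod>k<N. 1 + 1 / x k) ^ D *
        ((\<Prod>k<N. 1 + x k) ^ Q * (\<Prod>k<N. x k powr a * exp (- c * x k)))"
      unfolding laguerre_density_def Q_def using True C
      by (intro mult_mono mult_right_mono vandermonde_powr_le assms(4) prod_nonneg mult_nonneg_nonneg
          vandermonde_powr_nonneg zero_le_power
          order_trans[OF zero_le_one prod_one_plus_inverse_ge_1]) auto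
    also have "\<dots> = C * (\<Prod>k<N. (1 + 1 / x k) ^ D * (1 + x k) ^ Q * (x k powr a * exp (- c * x k)))"
      by (simp add: prod.distrib prod_power_distrib mult_ac)
    also have "\<dots> \<le> C * (\<Prod>k<N. K * gamma_envelope (c / 2) (x k))"
      using C(1) pos K(2)
      by (intro mult_left_mono prod_mono conjI)
        (auto intro!: mult_nonneg_nonneg zero_le_power add_nonneg_nonneg intro: less_imp_le)
    finally show ?thesis by (simp add: prod.distrib mult.assoc)
  qed
  then show ?thesis
    using C(1) K(1) by (intro exI[of _ "C * K ^ N"]) simp
qed

lemma ws_space_product_sigma_finite: "product_sigma_finite (\<lambda>_::nat. lborel :: real measure)"
  by standard

lemma integrable_mult_laguerre_weight:
  assumes "pole_order_le N D G" "real D + 1 \<le> a" "c > 0" "\<And>p. 0 \<le> \<gamma> p \<and> \<gamma> p \<le> B"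
  shows "integrable (ws_space N) (\<lambda>x. G x * laguerre_weight \<gamma> a c N x)"
proof -
  interpret product_sigma_finite "\<lambda>_::nat. lborel :: real measure"
    by (rule ws_space_product_sigma_finite)
  obtain K where K: "K \<ge> 0"
    "\<And>x. \<bar>G x * laguerre_weight \<gamma> a c N x\<bar> \<le> K * (\<Prod>k<N. gamma_envelope (c / 2) (x k))"
    using pole_order_le_laguerre_weight_bound[OF assms(1-3), of \<gamma> B] assms(4) by blast
  have "integrable (ws_space N) (\<lambda>x. K * (\<Prod>k<N. gamma_envelope (c / 2) (x k)))"
    unfolding ws_space_def using assms(3)
    by (intro integrable_mult_right product_integrable_prod integrable_gamma_envelope) auto
  then show ?thesis
  proof (rule Bochner_Integration.integrable_bound)
    show "(\<lambda>x. G x * laguerre_weight \<gamma> a c N x) \<in> borel_measurable (ws_space N)"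
      using assms(1) measurable_laguerre_weight by (auto simp: pole_order_le_def)
    show "AE x in ws_space N. norm (G x * laguerre_weight \<gamma> a c N x)
        \<le> norm (K * (\<Prod>k<N. gamma_envelope (c / 2) (x k)))"
      using K by (intro AE_I2) (simp add: abs_of_nonneg prod_nonneg gamma_envelope_nonneg)
  qed
qed

lemma integrable_mult_laguerre_weight_divide:
  assumes "pole_order_le N D G" "real D + 1 \<le> a" "c > 0" "\<And>p. 1 \<le> \<gamma> p \<and> \<gamma> p \<le> B"
    and "(i, j) \<in> index_pairs N"
  shows "integrable (ws_space N) (\<lambda>x. G x * (laguerre_weight \<gamma> a c N x / (x i - x j)))"
proof -
  let ?\<gamma> = "\<gamma>((i, j) := \<gamma> (i, j) - 1)"
  have "0 \<le> ?\<gamma> p \<and> ?\<gamma> p \<le> B" for p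
    using assms(4)[of p] by auto
  then have "integrable (ws_space N) (\<lambda>x. G x * laguerre_weight ?\<gamma> a c N x)"
    using assms(1-3) by (intro integrable_mult_laguerre_weight)
  then show ?thesis
  proof (rule Bochner_Integration.integrable_bound)
    have "i < N" "j < N"
      using assms(5) by (auto simp: index_pairs_iff)
    then have "(\<lambda>x. x i) \<in> borel_measurable (ws_space N)" "(\<lambda>x. x j) \<in> borel_measurable (ws_space N)"
      by (auto intro: measurable_ws_component)
    then show "(\<lambda>x. G x * (laguerre_weight \<gamma> a c N x / (x i - x j))) \<in> borel_measurable (ws_space N)"
      using assms(1) measurable_laguerre_weight by (auto simp: pole_order_le_def)
    show "AE x in ws_space N. norm (G x * (laguerre_weight \<gamma> a c N x / (x i - x j)))
        \<le> norm (G x * laguerre_weight ?\<gamma> a c N x)"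
      unfolding real_norm_def abs_mult abs_laguerre_weight_divide[OF assms(5)]
      by (intro AE_I2 mult_left_mono) auto
  qed
qed

section \<open>Integration by parts\<close>

lemma has_real_derivative_prod_log:
  fixes f :: "'a \<Rightarrow> real \<Rightarrow> real"
  assumes "\<And>s. s \<in> A \<Longrightarrow> (f s has_real_derivative f s y * l s) (at y)"
  shows "((\<lambda>y. \<Prod>s\<in>A. f s y) has_real_derivative (\<Prod>s\<in>A. f s y) * (\<Sum>s\<in>A. l s)) (at y)"
  using assms
proof (induction A rule: infinite_finite_induct)
  case (insert s A)
  have "((\<lambda>y. f s y * (\<Prod>s\<in>A. f s y)) has_real_derivative
      f s y * ((\<Prod>s\<in>A. f s y) * (\<Sum>s\<in>A. l s)) + f s y * l s * (\<Prod>s\<in>A. f s y)) (at y)"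
    using DERIV_mult'[OF insert.prems[of s] insert.IH] insert.prems by auto
  then show ?case
    using insert.hyps by (simp add: algebra_simps)
qed auto

lemma has_real_derivative_abs_powr:
  fixes t :: real
  assumes "t \<noteq> 0"
  shows "((\<lambda>t. \<bar>t\<bar> powr e) has_real_derivative \<bar>t\<bar> powr e * (e / t)) (at t)"
proof (cases "t > 0")
  case True
  have "((\<lambda>t. t powr e) has_real_derivative \<bar>t\<bar> powr e * (e / t)) (at t)"
    using True by (auto intro!: derivative_eq_intros simp: powr_diff)
  then show ?thesis
    by (rule has_field_derivative_transform_within_open[of _ _ _ "{0<..}"]) (use True in auto)
next
  case False
  have "((\<lambda>t. (- t) powr e) has_real_derivative \<bar>t\<bar> powr e * (e / t)) (at t)"
    using False assms by (auto intro!: derivative_eq_intros simp: powr_diff)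
  then show ?thesis
    by (rule has_field_derivative_transform_within_open[of _ _ _ "{..<0}"]) (use False assms in auto)
qed

lemma has_real_derivative_inverse_power:
  fixes y :: real
  assumes "y \<noteq> 0"
  shows "((\<lambda>y. 1 / y ^ k) has_real_derivative - real k * (1 / y ^ Suc k)) (at y)"
proof (cases k)
  case (Suc n)
  then show ?thesis
    using assms by (auto intro!: derivative_eq_intros simp: field_simps) (cases n, auto)
qed simp

definition vandermonde_drift :: "(nat \<times> nat \<Rightarrow> real) \<Rightarrow> nat \<Rightarrow> nat \<Rightarrow> (nat \<Rightarrow> real) \<Rightarrow> real" where
  "vandermonde_drift \<gamma> N i x =
     (\<Sum>(j, k)\<in>index_pairs N. \<gamma> (j, k) * (of_bool (j = i) - of_bool (k = i)) / (x j - x k))"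

definition laguerre_drift ::
    "(nat \<times> nat \<Rightarrow> real) \<Rightarrow> real \<Rightarrow> real \<Rightarrow> nat \<Rightarrow> nat \<Rightarrow> (nat \<Rightarrow> real) \<Rightarrow> real" where
  "laguerre_drift \<gamma> a c N i x = vandermonde_drift \<gamma> N i x + (a / x i - c)"

lemma vandermonde_powr_has_derivative:
  assumes "\<And>j. j < N \<Longrightarrow> j \<noteq> i \<Longrightarrow> y \<noteq> x j"
  shows "((\<lambda>y. vandermonde_powr \<gamma> N (x(i := y))) has_real_derivative
    vandermonde_powr \<gamma> N (x(i := y)) * vandermonde_drift \<gamma> N i (x(i := y))) (at y)"
  unfolding vandermonde_powr_def vandermonde_drift_def
proof (rule has_real_derivative_prod_log)
  fix p assume "p \<in> index_pairs N"
  then obtain j k where p: "p = (j, k)" and "j < k" "k < N"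
    by (cases p) (auto simp: index_pairs_iff)
  define g where "g t = (x(i := t)) j - (x(i := t)) k" for t
  have "((\<lambda>y. \<bar>g y\<bar> powr \<gamma> (j, k)) has_real_derivative
      \<bar>g y\<bar> powr \<gamma> (j, k) * (\<gamma> (j, k) * (of_bool (j = i) - of_bool (k = i)) / g y)) (at y)"
  proof (cases "g y = 0")
    case True
    then have "j \<noteq> i" "k \<noteq> i"
      using assms[of j] assms[of k] \<open>j < k\<close> \<open>k < N\<close> by (auto simp: g_def split: if_splits)
    then show ?thesis by (simp add: g_def)
  next
    case False
    have "(g has_real_derivative of_bool (j = i) - of_bool (k = i)) (at y)"
      unfolding g_def using \<open>j < k\<close>
      by (cases "j = i"; cases "k = i") (auto intro!: derivative_eq_intros)
    with has_real_derivative_abs_powr[OF False]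
    have "((\<lambda>y. \<bar>g y\<bar> powr \<gamma> (j, k)) has_real_derivative
        \<bar>g y\<bar> powr \<gamma> (j, k) * (\<gamma> (j, k) / g y) * (of_bool (j = i) - of_bool (k = i))) (at y)"
      by (rule DERIV_chain2)
    then show ?thesis
      by (simp only: mult.assoc times_divide_eq_left times_divide_eq_right)
  qed
  then show "((\<lambda>y. case p of (j, k) \<Rightarrow> \<bar>(x(i := y)) j - (x(i := y)) k\<bar> powr \<gamma> (j, k)) has_real_derivative
      (case p of (j, k) \<Rightarrow> \<bar>(x(i := y)) j - (x(i := y)) k\<bar> powr \<gamma> (j, k)) *
      (case p of (j, k) \<Rightarrow>
        \<gamma> (j, k) * (of_bool (j = i) - of_bool (k = i)) / ((x(i := y)) j - (x(i := y)) k))) (at y)"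
    by (simp only: p g_def prod.case)
qed

lemma laguerre_density_has_derivative:
  assumes "i < N" "y > 0" "\<And>j. j < N \<Longrightarrow> j \<noteq> i \<Longrightarrow> y \<noteq> x j"
  shows "((\<lambda>y. laguerre_density \<gamma> a c N (x(i := y))) has_real_derivative
    laguerre_density \<gamma> a c N (x(i := y)) * laguerre_drift \<gamma> a c N i (x(i := y))) (at y)"
proof -
  define p where "p t = (\<Prod>k<N. (x(i := t)) k powr a * exp (- c * (x(i := t)) k))" for t
  have "((\<lambda>y. (x(i := y)) k powr a * exp (- c * (x(i := y)) k)) has_real_derivative
      ((x(i := y)) k powr a * exp (- c * (x(i := y)) k)) * (if k = i then a / y - c else 0)) (at y)"
    for k
    using assms(2) by (cases "k = i") (auto intro!: derivative_eq_intros simp: powr_diff algebra_simps)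
  then have "(p has_real_derivative p y * (\<Sum>k<N. if k = i then a / y - c else 0)) (at y)"
    unfolding p_def by (intro has_real_derivative_prod_log)
  then have "(p has_real_derivative p y * (a / y - c)) (at y)"
    using assms(1) by simp
  from DERIV_mult'[OF vandermonde_powr_has_derivative[OF assms(3)] this] show ?thesis
    unfolding laguerre_density_def laguerre_drift_def p_def[symmetric]
    by (rule DERIV_cong) (simp_all add: algebra_simps)
qed

lemma laguerre_density_continuous:
  assumes "i < N" "\<And>p. \<gamma> p > 0"
  shows "continuous_on {0<..} (\<lambda>y. laguerre_density \<gamma> a c N (x(i := y)))"
proof -
  have coordinate: "continuous_on {0<..} (\<lambda>y. (x(i := y)) k)" for k
    by (cases "k = i") (simp_all add: continuous_on_id)
  have "continuous_on {0<..} (\<lambda>y. vandermonde_powr \<gamma> N (x(i := y)))"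
    unfolding vandermonde_powr_def
    using assms(2)
    by (auto intro!: continuous_on_prod continuous_on_powr' continuous_on_rabs continuous_on_diff
        coordinate continuous_on_const simp del: fun_upd_apply split: prod.splits)
  moreover have "continuous_on {0<..} (\<lambda>y. (x(i := y)) k powr a * exp (- c * (x(i := y)) k))" for k
    by (cases "k = i") (auto intro!: continuous_intros)
  ultimately show ?thesis
    unfolding laguerre_density_def by (intro continuous_on_mult[OF _ continuous_on_prod])
qed

lemma laguerre_weight_fun_upd:
  assumes "i < N" "y > 0"
  shows "laguerre_weight \<gamma> a c N (x(i := y)) =
    of_bool (\<forall>k<N. k \<noteq> i \<longrightarrow> x k > 0) * laguerre_density \<gamma> a c N (x(i := y))"
  using assms by (auto simp: laguerre_weight_def orthant_def indicator_def)

lemma laguerre_weight_has_derivative: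
  assumes "i < N" "y > 0" "\<And>j. j < N \<Longrightarrow> j \<noteq> i \<Longrightarrow> y \<noteq> x j"
  shows "((\<lambda>y. laguerre_weight \<gamma> a c N (x(i := y))) has_real_derivative
    laguerre_weight \<gamma> a c N (x(i := y)) * laguerre_drift \<gamma> a c N i (x(i := y))) (at y)"
proof (rule has_field_derivative_transform_within_open[of _ _ _ "{0<..}"])
  show "((\<lambda>y. of_bool (\<forall>k<N. k \<noteq> i \<longrightarrow> x k > 0) * laguerre_density \<gamma> a c N (x(i := y))) has_real_derivative
      laguerre_weight \<gamma> a c N (x(i := y)) * laguerre_drift \<gamma> a c N i (x(i := y))) (at y)"
  proof -
    have "((\<lambda>y. laguerre_density \<gamma> a c N (x(i := y))) has_real_derivative
        laguerre_density \<gamma> a c N (x(i := y)) * laguerre_drift \<gamma> a c N i (x(i := y))) (at y)"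
      using assms by (rule laguerre_density_has_derivative)
    from DERIV_cmult[OF this] show ?thesis
      by (simp only: laguerre_weight_fun_upd[OF assms(1,2)] mult.assoc)
  qed
qed (use assms in \<open>auto simp: laguerre_weight_fun_upd\<close>)

lemma laguerre_weight_continuous:
  assumes "i < N" "\<And>p. \<gamma> p > 0"
  shows "continuous_on {0<..} (\<lambda>y. laguerre_weight \<gamma> a c N (x(i := y)))"
proof -
  have "continuous_on {0<..}
      (\<lambda>y. of_bool (\<forall>k<N. k \<noteq> i \<longrightarrow> x k > 0) * laguerre_density \<gamma> a c N (x(i := y)))"
    using assms by (intro continuous_on_mult continuous_on_const laguerre_density_continuous)
  then show ?thesis
    by (rule continuous_on_eq) (simp add: laguerre_weight_fun_upd[OF assms(1)])
qed

lemma integral_ws_space_eq_0: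
  fixes f :: "(nat \<Rightarrow> real) \<Rightarrow> real"
  assumes "i < N" "integrable (ws_space N) f"
    and inner: "\<And>x. integrable lborel (\<lambda>y. f (x(i := y))) \<Longrightarrow> (\<integral>y. f (x(i := y)) \<partial>lborel) = 0"
  shows "(\<integral>x. f x \<partial>ws_space N) = 0"
proof -
  interpret product_sigma_finite "\<lambda>_::nat. lborel :: real measure"
    by (rule ws_space_product_sigma_finite)
  have insert_i: "insert i ({..<N} - {i}) = {..<N}"
    using assms(1) by auto
  have "(\<integral>y. f (x(i := y)) \<partial>lborel) = 0" for x
    using inner[of x] not_integrable_integral_eq by blast
  moreover have "(\<integral>x. f x \<partial>ws_space N) =
      (\<integral>x. (\<integral>y. f (x(i := y)) \<partial>lborel) \<partial>Pi\<^sub>M ({..<N} - {i}) (\<lambda>_. lborel))"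
    using assms(2) unfolding ws_space_def
    by (intro product_integral_insert[of "{..<N} - {i}" i f, unfolded insert_i]) auto
  ultimately show ?thesis by simp
qed

lemma tendsto_0_mult_laguerre_weight_line:
  assumes "pole_order_le N D G" "real D + 1 \<le> a" "c > 0" "\<And>p. 0 \<le> \<gamma> p \<and> \<gamma> p \<le> B" "i < N"
    and "(gamma_envelope (c / 2) \<longlongrightarrow> 0) F"
  shows "((\<lambda>y. G (x(i := y)) * laguerre_weight \<gamma> a c N (x(i := y))) \<longlongrightarrow> 0) F"
proof -
  obtain K where K: "\<And>x. \<bar>G x * laguerre_weight \<gamma> a c N x\<bar> \<le> K * (\<Prod>k<N. gamma_envelope (c / 2) (x k))"
    using pole_order_le_laguerre_weight_bound[OF assms(1-3), of \<gamma> B] assms(4) by blast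
  define C where "C = (\<Prod>k\<in>{..<N} - {i}. gamma_envelope (c / 2) (x k))"
  have "(\<Prod>k<N. gamma_envelope (c / 2) ((x(i := y)) k)) = gamma_envelope (c / 2) y * C" for y
    using assms(5) by (subst prod.remove[of _ i]) (auto simp: C_def)
  then have "norm (G (x(i := y)) * laguerre_weight \<gamma> a c N (x(i := y)))
      \<le> K * (gamma_envelope (c / 2) y * C)" for y
    using K[of "x(i := y)"] by simp
  moreover have "((\<lambda>y. K * (gamma_envelope (c / 2) y * C)) \<longlongrightarrow> 0) F"
    by (intro tendsto_mult_right_zero tendsto_mult_left_zero assms(6))
  ultimately show ?thesis
    by (rule Lim_null_comparison[OF always_eventually[OF allI]])
qed

text \<open>The assumption \<open>\<gamma> p \<ge> 1\<close> makes the poles of the drift integrable.\<close>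
lemma integrable_laguerre_divergence:
  assumes "\<And>p. 1 \<le> \<gamma> p \<and> \<gamma> p \<le> B" "c > 0" "real D + 2 \<le> a" "i < N"
    and G: "pole_order_le N D G" "pole_order_le N (Suc D) G'"
  shows "integrable (ws_space N)
    (\<lambda>x. (G' x + G x * laguerre_drift \<gamma> a c N i x) * laguerre_weight \<gamma> a c N x)"
proof -
  let ?w = "laguerre_weight \<gamma> a c N"
  have D: "real (Suc D) + 1 \<le> a" "real D + 1 \<le> a"
    using assms(3) by auto
  have \<gamma>: "0 \<le> \<gamma> p \<and> \<gamma> p \<le> B" for p
    using assms(1)[of p] by auto
  have "pole_order_le N (D + 1) (\<lambda>x. G x * (1 / x i ^ 1))"
    by (intro pole_order_le_mult G pole_order_le_inverse_power assms(4))
  then have G_div: "pole_order_le N (Suc D) (\<lambda>x. G x * (1 / x i))"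
    by simp
  have "integrable (ws_space N) (\<lambda>x. G' x * ?w x
     + (\<Sum>p\<in>index_pairs N.
          \<gamma> p * (of_bool (fst p = i) - of_bool (snd p = i)) * (G x * (?w x / (x (fst p) - x (snd p)))))
     + a * (G x * (1 / x i) * ?w x) - c * (G x * ?w x))"
    by (intro Bochner_Integration.integrable_add Bochner_Integration.integrable_diff
        Bochner_Integration.integrable_sum integrable_mult_right
        integrable_mult_laguerre_weight[OF G(1) D(2) assms(2) \<gamma>]
        integrable_mult_laguerre_weight[OF G(2) D(1) assms(2) \<gamma>]
        integrable_mult_laguerre_weight[OF G_div D(1) assms(2) \<gamma>]
        integrable_mult_laguerre_weight_divide[OF G(1) D(2) assms(2,1)]) simp
  then show ?thesis
    by (simp add: laguerre_drift_def vandermonde_drift_def case_prod_unfold sum_distrib_left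
        algebra_simps)
qed

lemma laguerre_integration_by_parts:
  assumes \<gamma>: "\<And>p. 1 \<le> \<gamma> p \<and> \<gamma> p \<le> B" and "c > 0" "real D + 2 \<le> a" "i < N"
    and G: "pole_order_le N D G" "pole_order_le N (Suc D) G'"
    and deriv: "\<And>x y. y > 0 \<Longrightarrow> ((\<lambda>y. G (x(i := y))) has_real_derivative G' (x(i := y))) (at y)"
  shows "(\<integral>x. (G' x + G x * laguerre_drift \<gamma> a c N i x) * laguerre_weight \<gamma> a c N x \<partial>ws_space N) = 0"
proof (rule integral_ws_space_eq_0[OF assms(4) integrable_laguerre_divergence[OF assms(1-6)]])
  fix x :: "nat \<Rightarrow> real"
  let ?w = "\<lambda>y. laguerre_weight \<gamma> a c N (x(i := y))"
  let ?f' = "\<lambda>y. (G' (x(i := y)) + G (x(i := y)) * laguerre_drift \<gamma> a c N i (x(i := y))) * ?w y"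
  assume f'_integrable: "integrable lborel ?f'"
  have "(\<integral>y. ?f' y \<partial>lborel) = 0 - 0"
  proof (rule integral_derivative_half_line[where E = "x ` {..<N}" and f = "\<lambda>y. G (x(i := y)) * ?w y"])
    show "((\<lambda>y. G (x(i := y)) * ?w y) has_real_derivative ?f' y) (at y)"
      if "y > 0" "y \<notin> x ` {..<N}" for y
    proof -
      have "(?w has_real_derivative ?w y * laguerre_drift \<gamma> a c N i (x(i := y))) (at y)"
        using that by (intro laguerre_weight_has_derivative assms(4)) auto
      from DERIV_mult'[OF deriv[OF that(1)] this] show ?thesis
        by (rule DERIV_cong) (simp add: algebra_simps)
    qed
    have "continuous_on {0<..} (\<lambda>y. G (x(i := y)))"
      by (rule DERIV_continuous_on, rule has_field_derivative_at_within, rule deriv) simp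
    moreover have "continuous_on {0<..} ?w"
      using assms(4) \<gamma>
      by (intro laguerre_weight_continuous) (auto intro: less_le_trans[OF zero_less_one])
    ultimately show "continuous_on {0<..} (\<lambda>y. G (x(i := y)) * ?w y)"
      by (rule continuous_on_mult)
    show "?f' y = 0" if "y \<le> 0" for y
    proof -
      have "x(i := y) \<notin> orthant N"
        using that assms(4) by (auto simp: orthant_def)
      then show ?thesis by (simp add: laguerre_weight_eq_0_outside)
    qed
    have "((\<lambda>y. G (x(i := y)) * ?w y) \<longlongrightarrow> 0) F" if "(gamma_envelope (c / 2) \<longlongrightarrow> 0) F" for F
      using \<gamma> assms(3) that
      by (intro tendsto_0_mult_laguerre_weight_line[OF G(1) _ assms(2) _ assms(4), of a \<gamma> B])
        (auto intro: order_trans[OF zero_le_one])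
    then show "((\<lambda>y. G (x(i := y)) * ?w y) \<longlongrightarrow> 0) (at_right 0)" "((\<lambda>y. G (x(i := y)) * ?w y) \<longlongrightarrow> 0) at_top"
      using assms(2) by (simp_all add: gamma_envelope_at_right_0 gamma_envelope_at_top)
  qed (use f'_integrable in auto)
  then show "(\<integral>y. ?f' y \<partial>lborel) = 0"
    by simp
qed

section \<open>The loop equation for moments\<close>

definition inverse_power_sum :: "nat \<Rightarrow> nat \<Rightarrow> (nat \<Rightarrow> real) \<Rightarrow> real" where
  "inverse_power_sum N k x = (\<Sum>i<N. 1 / x i ^ k)"

lemma inverse_power_sum_eq_ws_T: "N > 0 \<Longrightarrow> inverse_power_sum N k x = real N * ws_T k N x"
  by (simp add: inverse_power_sum_def ws_T_def)

lemma index_pairs_Suc: "index_pairs (Suc N) = index_pairs N \<union> (\<lambda>i. (i, N)) ` {..<N}"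
  by (auto simp: index_pairs_def)

lemma sum_square_eq_sum_index_pairs:
  fixes H :: "nat \<Rightarrow> nat \<Rightarrow> real"
  assumes sym: "\<And>i j. H i j = H j i"
  shows "(\<Sum>i<N. \<Sum>j<N. H i j) = 2 * (\<Sum>(i, j)\<in>index_pairs N. H i j) + (\<Sum>i<N. H i i)"
proof (induction N)
  case 0
  then show ?case by (simp add: index_pairs_def)
next
  case (Suc N)
  have reflect: "(\<Sum>j<N. H N j) = (\<Sum>i<N. H i N)"
    by (intro sum.cong refl sym)
  have "(\<Sum>(i, j)\<in>index_pairs (Suc N). H i j)
      = (\<Sum>(i, j)\<in>index_pairs N. H i j) + (\<Sum>(i, j)\<in>(\<lambda>i. (i, N)) ` {..<N}. H i j)"
    unfolding index_pairs_Suc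
    by (rule sum.union_disjoint) (auto simp: finite_index_pairs index_pairs_iff)
  also have "(\<Sum>(i, j)\<in>(\<lambda>i. (i, N)) ` {..<N}. H i j) = (\<Sum>i<N. H i N)"
    by (subst sum.reindex) (auto simp: inj_on_def)
  finally show ?case
    using Suc reflect by (simp add: sum.distrib)
qed

lemma inverse_power_difference_quotient:
  fixes x y :: real
  assumes "x \<noteq> 0" "y \<noteq> 0" "x \<noteq> y"
  shows "(1 / x ^ k - 1 / y ^ k) / (x - y) = - (\<Sum>a<k. 1 / x ^ Suc a * (1 / y ^ (k - a)))"
proof -
  define u v where "u = 1 / x" and "v = 1 / y"
  have "1 / x ^ k - 1 / y ^ k = u ^ k - v ^ k"
    by (simp add: u_def v_def power_one_over)
  also have "\<dots> = (u - v) * (\<Sum>a<k. v ^ (k - Suc a) * u ^ a)"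
    by (rule power_diff_sumr2)
  also have "u - v = - (x - y) * (u * v)"
    using assms by (simp add: u_def v_def field_simps)
  finally have "(1 / x ^ k - 1 / y ^ k) / (x - y) = - (u * v * (\<Sum>a<k. v ^ (k - Suc a) * u ^ a))"
    using assms(3) by (simp add: field_simps)
  also have "u * v * (\<Sum>a<k. v ^ (k - Suc a) * u ^ a) = (\<Sum>a<k. u ^ Suc a * v ^ (k - a))"
    unfolding sum_distrib_left
  proof (rule sum.cong[OF refl])
    fix a assume "a \<in> {..<k}"
    then have "k - a = Suc (k - Suc a)" by auto
    then show "u * v * (v ^ (k - Suc a) * u ^ a) = u ^ Suc a * v ^ (k - a)" by simp
  qed
  finally show ?thesis
    by (simp add: u_def v_def power_one_over)
qed

lemma sum_inverse_power_difference_quotients: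
  fixes x :: "nat \<Rightarrow> real"
  assumes "x \<in> orthant N" "inj_on x {..<N}"
  defines "p \<equiv> \<lambda>j. inverse_power_sum N j x"
  shows "2 * (\<Sum>(i, j)\<in>index_pairs N. (1 / x i ^ k - 1 / x j ^ k) / (x i - x j))
      = real k * p (Suc k) - (\<Sum>a<k. p (Suc a) * p (k - a))"
proof -
  define H where "H i j = (\<Sum>a<k. 1 / x i ^ Suc a * (1 / x j ^ (k - a)))" for i j
  have sym: "H i j = H j i" for i j
    unfolding H_def
    by (subst sum.nat_diff_reindex[symmetric], intro sum.cong refl) (simp add: Suc_diff_Suc mult.commute)
  have "(\<Sum>i<N. \<Sum>j<N. H i j) = (\<Sum>i<N. \<Sum>a<k. \<Sum>j<N. 1 / x i ^ Suc a * (1 / x j ^ (k - a)))"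
    unfolding H_def by (intro sum.cong refl sum.swap)
  also have "\<dots> = (\<Sum>a<k. \<Sum>i<N. \<Sum>j<N. 1 / x i ^ Suc a * (1 / x j ^ (k - a)))"
    by (rule sum.swap)
  also have "\<dots> = (\<Sum>a<k. p (Suc a) * p (k - a))"
    by (simp only: p_def inverse_power_sum_def sum_product)
  finally have square: "(\<Sum>i<N. \<Sum>j<N. H i j) = (\<Sum>a<k. p (Suc a) * p (k - a))" .
  have "H i i = (\<Sum>a<k. 1 / x i ^ Suc k)" for i
    unfolding H_def by (rule sum.cong[OF refl]) (simp flip: power_add)
  then have diagonal: "(\<Sum>i<N. H i i) = real k * p (Suc k)"
    by (simp add: p_def inverse_power_sum_def sum_distrib_left)
  have "(\<Sum>(i, j)\<in>index_pairs N. (1 / x i ^ k - 1 / x j ^ k) / (x i - x j))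
      = (\<Sum>(i, j)\<in>index_pairs N. - H i j)"
  proof (intro sum.cong refl, clarify)
    fix i j assume "(i, j) \<in> index_pairs N"
    then have "i < j" "j < N"
      by (simp_all add: index_pairs_iff)
    then have "x i > 0" "x j > 0" "x i \<noteq> x j"
      using assms(1) inj_onD[OF assms(2), of i j] by (auto simp: orthant_def)
    then have "x i \<noteq> 0" "x j \<noteq> 0" "x i \<noteq> x j"
      by auto
    then show "(1 / x i ^ k - 1 / x j ^ k) / (x i - x j) = - H i j"
      unfolding H_def by (rule inverse_power_difference_quotient)
  qed
  then show ?thesis
    using sum_square_eq_sum_index_pairs[of H N, OF sym] square diagonal
    by (simp add: case_prod_unfold sum_negf)
qed

lemma sum_mult_vandermonde_drift:
  "(\<Sum>i<N. g i * vandermonde_drift \<gamma> N i x)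
    = (\<Sum>(j, k)\<in>index_pairs N. \<gamma> (j, k) * ((g j - g k) / (x j - x k)))"
proof -
  have "(\<Sum>i<N. g i * vandermonde_drift \<gamma> N i x)
      = (\<Sum>(j, k)\<in>index_pairs N. \<Sum>i<N.
           g i * (\<gamma> (j, k) * (of_bool (j = i) - of_bool (k = i)) / (x j - x k)))"
    unfolding vandermonde_drift_def sum_distrib_left case_prod_unfold by (rule sum.swap)
  also have "\<dots> = (\<Sum>(j, k)\<in>index_pairs N. \<gamma> (j, k) * ((g j - g k) / (x j - x k)))"
  proof (intro sum.cong refl, clarify)
    fix j k assume "(j, k) \<in> index_pairs N"
    then have "j < N" "k < N"
      by (simp_all add: index_pairs_iff)
    moreover have "(\<Sum>i<N. g i * of_bool (l = i)) = g l" if "l < N" for l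
      using that by (simp add: of_bool_def if_distrib cong: if_cong)
    ultimately have "(\<Sum>i<N. g i * (of_bool (j = i) - of_bool (k = i))) = g j - g k"
      by (simp only: right_diff_distrib sum_subtractf)
    then have "\<gamma> (j, k) * ((g j - g k) / (x j - x k))
        = \<gamma> (j, k) * ((\<Sum>i<N. g i * (of_bool (j = i) - of_bool (k = i))) / (x j - x k))"
      by simp
    then show "(\<Sum>i<N. g i * (\<gamma> (j, k) * (of_bool (j = i) - of_bool (k = i)) / (x j - x k)))
        = \<gamma> (j, k) * ((g j - g k) / (x j - x k))"
      by (simp add: sum_distrib_left sum_divide_distrib mult_ac)
  qed
  finally show ?thesis .
qed

lemma sum_inverse_power_mult_laguerre_drift:
  fixes x :: "nat \<Rightarrow> real"
  assumes "x \<in> orthant N" "inj_on x {..<N}"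
  defines "p \<equiv> \<lambda>j. inverse_power_sum N j x"
  shows "(\<Sum>i<N. 1 / x i ^ k * laguerre_drift (\<lambda>_. \<beta>) a c N i x)
    = \<beta> / 2 * (real k * p (Suc k) - (\<Sum>j<k. p (Suc j) * p (k - j))) + (a * p (Suc k) - c * p k)"
proof -
  have "1 / x i ^ k * (a / x i - c) = a * (1 / x i ^ Suc k) - c * (1 / x i ^ k)" for i
    by (simp add: diff_divide_distrib)
  then have "(\<Sum>i<N. 1 / x i ^ k * (a / x i - c)) = a * p (Suc k) - c * p k"
    by (simp only: p_def inverse_power_sum_def sum_subtractf sum_distrib_left)
  moreover have "(\<Sum>(i, j)\<in>index_pairs N. \<beta> * ((1 / x i ^ k - 1 / x j ^ k) / (x i - x j)))
      = \<beta> / 2 * (2 * (\<Sum>(i, j)\<in>index_pairs N. (1 / x i ^ k - 1 / x j ^ k) / (x i - x j)))"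
    by (simp only: sum_distrib_left case_prod_unfold mult.assoc[symmetric]) simp
  then have "(\<Sum>(i, j)\<in>index_pairs N. \<beta> * ((1 / x i ^ k - 1 / x j ^ k) / (x i - x j)))
      = \<beta> / 2 * (real k * p (Suc k) - (\<Sum>j<k. p (Suc j) * p (k - j)))"
    by (simp only: p_def sum_inverse_power_difference_quotients[OF assms(1,2)])
  ultimately show ?thesis
    by (simp only: laguerre_drift_def distrib_left sum.distrib sum_mult_vandermonde_drift)
qed

abbreviation ws_drift :: "real \<Rightarrow> nat \<Rightarrow> nat \<Rightarrow> (nat \<Rightarrow> real) \<Rightarrow> real" where
  "ws_drift \<beta> N \<equiv> laguerre_drift (\<lambda>_. \<beta>) (\<beta> * real N / 2) (\<beta> * real N / 2) N"

abbreviation T_prod :: "nat \<Rightarrow> nat list \<Rightarrow> (nat \<Rightarrow> real) \<Rightarrow> real" where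
  "T_prod N ks x \<equiv> (\<Prod>k\<leftarrow>ks. ws_T k N x)"

lemma pole_order_le_ws_T: "pole_order_le N k (ws_T k N)"
  unfolding ws_T_def[abs_def]
  by (intro pole_order_le_cmult pole_order_le_sum pole_order_le_inverse_power) simp

lemma pole_order_le_T_prod: "pole_order_le N (sum_list ks) (T_prod N ks)"
  by (induction ks) (auto intro: pole_order_le_const pole_order_le_mult pole_order_le_ws_T)

lemma ws_T_has_derivative:
  assumes "i < N" "y > 0"
  shows "((\<lambda>y. ws_T k N (x(i := y))) has_real_derivative - (real k / real N) * (1 / y ^ (k + 1))) (at y)"
proof -
  have "((\<lambda>y. 1 / (x(i := y)) j ^ k) has_real_derivative
      (if j = i then - real k * (1 / y ^ (k + 1)) else 0)) (at y)" for j
    using has_real_derivative_inverse_power[of y k] assms(2) by (cases "j = i") simp_all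
  then have "((\<lambda>y. \<Sum>j<N. 1 / (x(i := y)) j ^ k) has_real_derivative
      (\<Sum>j<N. if j = i then - real k * (1 / y ^ (k + 1)) else 0)) (at y)"
    by (intro DERIV_sum)
  from DERIV_cmult[OF this, of "1 / real N"] show ?thesis
    using assms(1) by (simp add: ws_T_def)
qed

lemma has_real_derivative_prod_list:
  fixes f :: "'a \<Rightarrow> real \<Rightarrow> real"
  assumes "\<And>k. k \<in> set ks \<Longrightarrow> (f k has_real_derivative f' k) (at y)"
  shows "((\<lambda>y. \<Prod>k\<leftarrow>ks. f k y) has_real_derivative sum_extract (\<lambda>k js. f' k * (\<Prod>j\<leftarrow>js. f j y)) ks) (at y)"
  using assms
proof (induction ks)
  case (Cons k ks)
  have "((\<lambda>y. f k y * (\<Prod>k\<leftarrow>ks. f k y)) has_real_derivative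
      f k y * sum_extract (\<lambda>k js. f' k * (\<Prod>j\<leftarrow>js. f j y)) ks + f' k * (\<Prod>k\<leftarrow>ks. f k y)) (at y)"
    using Cons by (intro DERIV_mult') auto
  moreover have "sum_extract (\<lambda>j js. f' j * (f k y * (\<Prod>j\<leftarrow>js. f j y))) ks
      = f k y * sum_extract (\<lambda>j js. f' j * (\<Prod>j\<leftarrow>js. f j y)) ks"
    by (simp only: mult.left_commute[of "f' _"] sum_extract_mult_left)
  ultimately show ?case
    by (simp add: add.commute)
qed simp

definition T_prod_deriv :: "nat \<Rightarrow> nat list \<Rightarrow> nat \<Rightarrow> (nat \<Rightarrow> real) \<Rightarrow> real" where
  "T_prod_deriv N ks i x =
     sum_extract (\<lambda>j js. - (real j / real N) * (1 / x i ^ (j + 1)) * T_prod N js x) ks"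

lemma T_prod_has_derivative:
  assumes "i < N" "y > 0"
  shows "((\<lambda>y. T_prod N ks (x(i := y))) has_real_derivative T_prod_deriv N ks i (x(i := y))) (at y)"
  unfolding T_prod_deriv_def fun_upd_same
  using assms by (intro has_real_derivative_prod_list ws_T_has_derivative)

lemma pole_order_le_T_prod_deriv:
  assumes "i < N"
  shows "pole_order_le N (Suc (sum_list ks)) (T_prod_deriv N ks i)"
  unfolding T_prod_deriv_def[abs_def]
proof (rule pole_order_le_sum_extract)
  fix j js assume "add_mset j (mset js) = mset ks"
  moreover have "pole_order_le N (j + 1 + sum_list js)
      (\<lambda>x. - (real j / real N) * (1 / x i ^ (j + 1)) * T_prod N js x)"
    by (intro pole_order_le_mult[OF pole_order_le_cmult] pole_order_le_inverse_power
        pole_order_le_T_prod assms)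
  ultimately show "pole_order_le N (Suc (sum_list ks))
      (\<lambda>x. - (real j / real N) * (1 / x i ^ (j + 1)) * T_prod N js x)"
    using mset_Cons_eqD(1)[of j js ks] by simp
qed

lemma sum_inverse_power_mult_T_prod_deriv:
  assumes "N > 0"
  shows "(\<Sum>i<N. 1 / x i ^ k * T_prod_deriv N ks i x)
    = - sum_extract (\<lambda>j js. real j * T_prod N ((j + k + 1) # js) x) ks"
proof -
  have "(\<Sum>i<N. 1 / x i ^ k * T_prod_deriv N ks i x)
      = sum_extract (\<lambda>j js. - (real j / real N) * T_prod N js x * inverse_power_sum N (j + k + 1) x) ks"
    unfolding T_prod_deriv_def sum_extract_def inverse_power_sum_def sum_distrib_left
    by (subst sum.swap) (simp add: power_add mult_ac)
  also have "\<dots> = - sum_extract (\<lambda>j js. real j * T_prod N ((j + k + 1) # js) x) ks"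
    using assms by (simp add: inverse_power_sum_eq_ws_T sum_extract_def sum_negf mult_ac)
  finally show ?thesis .
qed

definition T_field :: "nat \<Rightarrow> nat \<Rightarrow> nat list \<Rightarrow> nat \<Rightarrow> (nat \<Rightarrow> real) \<Rightarrow> real" where
  "T_field N k ks i x = 1 / x i ^ k * T_prod N ks x"

definition T_field_deriv :: "nat \<Rightarrow> nat \<Rightarrow> nat list \<Rightarrow> nat \<Rightarrow> (nat \<Rightarrow> real) \<Rightarrow> real" where
  "T_field_deriv N k ks i x =
     1 / x i ^ k * T_prod_deriv N ks i x + - real k * (1 / x i ^ Suc k) * T_prod N ks x"

lemma T_field_has_derivative:
  assumes "i < N" "y > 0"
  shows "((\<lambda>y. T_field N k ks i (x(i := y))) has_real_derivative
    T_field_deriv N k ks i (x(i := y))) (at y)"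
  unfolding T_field_def T_field_deriv_def fun_upd_same using assms
  by (intro DERIV_mult' has_real_derivative_inverse_power T_prod_has_derivative) auto

lemma pole_order_le_T_field: "i < N \<Longrightarrow> pole_order_le N (k + sum_list ks) (T_field N k ks i)"
  unfolding T_field_def[abs_def]
  by (intro pole_order_le_mult pole_order_le_inverse_power pole_order_le_T_prod)

lemma pole_order_le_T_field_deriv:
  assumes "i < N"
  shows "pole_order_le N (Suc (k + sum_list ks)) (T_field_deriv N k ks i)"
  unfolding T_field_deriv_def[abs_def]
proof (rule pole_order_le_add)
  have "pole_order_le N (k + Suc (sum_list ks)) (\<lambda>x. 1 / x i ^ k * T_prod_deriv N ks i x)"
    by (intro pole_order_le_mult pole_order_le_inverse_power pole_order_le_T_prod_deriv assms)
  then show "pole_order_le N (Suc (k + sum_list ks)) (\<lambda>x. 1 / x i ^ k * T_prod_deriv N ks i x)"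
    by simp
  have "pole_order_le N (Suc k + sum_list ks) (\<lambda>x. - real k * (1 / x i ^ Suc k) * T_prod N ks x)"
    by (intro pole_order_le_mult[OF pole_order_le_cmult] pole_order_le_inverse_power
        pole_order_le_T_prod assms)
  then show "pole_order_le N (Suc (k + sum_list ks)) (\<lambda>x. - real k * (1 / x i ^ Suc k) * T_prod N ks x)"
    by simp
qed

lemma sum_T_field_deriv:
  assumes "N > 0"
  shows "(\<Sum>i<N. T_field_deriv N k ks i x)
    = - sum_extract (\<lambda>j js. real j * T_prod N ((j + k + 1) # js) x) ks
      - real k * (real N * T_prod N (Suc k # ks) x)"
proof -
  have "(\<Sum>i<N. - real k * (1 / x i ^ Suc k) * T_prod N ks x)
      = - real k * inverse_power_sum N (Suc k) x * T_prod N ks x"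
    by (simp only: inverse_power_sum_def sum_distrib_left sum_distrib_right)
  then show ?thesis
    unfolding T_field_deriv_def sum.distrib sum_inverse_power_mult_T_prod_deriv[OF assms]
    using assms by (simp add: inverse_power_sum_eq_ws_T)
qed

definition T_loop_rhs :: "real \<Rightarrow> nat \<Rightarrow> nat \<Rightarrow> nat list \<Rightarrow> (nat \<Rightarrow> real) \<Rightarrow> real" where
  "T_loop_rhs \<beta> N k ks x = T_prod N (k # ks) x + (\<Sum>a<k. T_prod N (Suc a # (k - a) # ks) x)
     + 2 / (\<beta> * (real N)\<^sup>2) * sum_extract (\<lambda>j js. real j * T_prod N ((j + k + 1) # js) x) ks"

lemma sum_T_field_divergence:
  assumes "N > 0" "\<beta> > 0" "x \<in> orthant N" "inj_on x {..<N}"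
  shows "(\<Sum>i<N. T_field_deriv N k ks i x + T_field N k ks i x * ws_drift \<beta> N i x)
    = \<beta> * (real N)\<^sup>2 / 2 * ((1 + real k / real N * (1 - 2 / \<beta>)) * T_prod N (Suc k # ks) x
        - T_loop_rhs \<beta> N k ks x)"
proof -
  define F where "F = T_prod N ks x"
  define T where "T j = ws_T j N x" for j
  define S where "S = (\<Sum>a<k. T (Suc a) * T (k - a))"
  have pairs: "(\<Sum>a<k. T_prod N (Suc a # (k - a) # ks) x) = S * F"
    by (simp add: F_def T_def S_def sum_distrib_right mult.assoc)
  have heads: "T_prod N (j # ks) x = T j * F" for j
    by (simp add: F_def T_def)
  have "(\<Sum>a<k. real N * T (Suc a) * (real N * T (k - a))) = (real N)\<^sup>2 * S"
    by (simp add: S_def sum_distrib_left power2_eq_square mult_ac)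
  moreover have "(\<Sum>i<N. T_field N k ks i x * ws_drift \<beta> N i x)
      = F * (\<Sum>i<N. 1 / x i ^ k * ws_drift \<beta> N i x)"
    by (simp only: T_field_def F_def sum_distrib_left mult_ac)
  ultimately have drift: "(\<Sum>i<N. T_field N k ks i x * ws_drift \<beta> N i x)
      = F * (\<beta> / 2 * (real k * (real N * T (Suc k)) - (real N)\<^sup>2 * S)
          + (\<beta> * real N / 2 * (real N * T (Suc k)) - \<beta> * real N / 2 * (real N * T k)))"
    unfolding T_def
    by (simp only: sum_inverse_power_mult_laguerre_drift[OF assms(3,4)]
        inverse_power_sum_eq_ws_T[OF assms(1)])
  show ?thesis
    unfolding T_loop_rhs_def sum.distrib sum_T_field_deriv[OF assms(1)] pairs heads drift
    using assms(1,2) by (simp add: field_simps power2_eq_square)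
qed

lemma pole_order_le_T_prod_le: "sum_list ks \<le> D \<Longrightarrow> pole_order_le N D (T_prod N ks)"
  using pole_order_le_T_prod by (rule pole_order_le_mono)

lemma integrable_mult_ws_weight:
  assumes "\<beta> \<ge> 1" "real D + 1 \<le> \<beta> * real N / 2" "pole_order_le N D f"
  shows "integrable (ws_space N) (\<lambda>x. f x * ws_weight \<beta> N x)"
  unfolding ws_weight_eq_laguerre_weight
  using assms by (intro integrable_mult_laguerre_weight[of N D _ _ _ _ \<beta>]) auto

lemma ws_expect_cmult: "ws_expect \<beta> N (\<lambda>x. a * f x) = a * ws_expect \<beta> N f"
  by (simp add: ws_expect_def mult.assoc)

context
  fixes \<beta> :: real and N D :: nat
  assumes \<beta>: "\<beta> \<ge> 1" and degree: "real D + 1 \<le> \<beta> * real N / 2"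
begin

lemma ws_expect_add:
  assumes "pole_order_le N D f" "pole_order_le N D g"
  shows "ws_expect \<beta> N (\<lambda>x. f x + g x) = ws_expect \<beta> N f + ws_expect \<beta> N g"
  using assms[THEN integrable_mult_ws_weight[OF \<beta> degree]]
  by (simp add: ws_expect_def distrib_right add_divide_distrib)

lemma ws_expect_sum:
  assumes "\<And>i. i \<in> I \<Longrightarrow> pole_order_le N D (f i)"
  shows "ws_expect \<beta> N (\<lambda>x. \<Sum>i\<in>I. f i x) = (\<Sum>i\<in>I. ws_expect \<beta> N (f i))"
  using assms[THEN integrable_mult_ws_weight[OF \<beta> degree]]
  by (simp add: ws_expect_def sum_distrib_right Bochner_Integration.integral_sum sum_divide_distrib)

lemma ws_expect_sum_extract:
  assumes "\<And>y ys. add_mset y (mset ys) = mset xs \<Longrightarrow> pole_order_le N D (f y ys)"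
  shows "ws_expect \<beta> N (\<lambda>x. sum_extract (\<lambda>y ys. f y ys x) xs)
      = sum_extract (\<lambda>y ys. ws_expect \<beta> N (f y ys)) xs"
  unfolding sum_extract_def by (intro ws_expect_sum assms mset_nth_nths) simp

end

lemma ws_integral_T_field_divergence:
  assumes "\<beta> \<ge> 1" "real (k + sum_list ks) + 2 \<le> \<beta> * real N / 2"
  shows "(\<integral>x. (\<Sum>i<N. T_field_deriv N k ks i x + T_field N k ks i x * ws_drift \<beta> N i x)
           * ws_weight \<beta> N x \<partial>ws_space N) = 0"
proof -
  let ?div = "\<lambda>i x. (T_field_deriv N k ks i x + T_field N k ks i x * ws_drift \<beta> N i x) * ws_weight \<beta> N x"
  have rate: "\<beta> * real N / 2 > 0"
    using assms(2) by linarith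
  have exponents: "1 \<le> \<beta> \<and> \<beta> \<le> \<beta>"
    using assms(1) by simp
  have "integrable (ws_space N) (?div i)" if "i < N" for i
    unfolding ws_weight_eq_laguerre_weight
    using exponents rate assms(2) that pole_order_le_T_field[OF that]
      pole_order_le_T_field_deriv[OF that]
    by (rule integrable_laguerre_divergence)
  moreover have "(\<integral>x. ?div i x \<partial>ws_space N) = 0" if "i < N" for i
    unfolding ws_weight_eq_laguerre_weight
    using exponents rate assms(2) that pole_order_le_T_field[OF that]
      pole_order_le_T_field_deriv[OF that]
      T_field_has_derivative[OF that]
    by (rule laguerre_integration_by_parts)
  ultimately show ?thesis
    unfolding sum_distrib_right by (subst Bochner_Integration.integral_sum) auto
qed

lemma ws_expect_loop_defect_eq_0:
  assumes \<beta>: "\<beta> \<ge> 1" and degree: "real (k + sum_list ks) + 2 \<le> \<beta> * real N / 2"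
  shows "ws_expect \<beta> N (\<lambda>x. (1 + real k / real N * (1 - 2 / \<beta>)) * T_prod N (Suc k # ks) x
      + - 1 * T_loop_rhs \<beta> N k ks x) = 0"
    (is "ws_expect \<beta> N ?defect = 0")
proof -
  have "N \<noteq> 0"
    using degree by (intro notI) (simp add: add_nonneg_pos not_le)
  have "(\<Sum>i<N. T_field_deriv N k ks i x
        + T_field N k ks i x * ws_drift \<beta> N i x) * ws_weight \<beta> N x
      = \<beta> * (real N)\<^sup>2 / 2 * ?defect x * ws_weight \<beta> N x" for x
  proof (cases "ws_weight \<beta> N x = 0")
    case False
    then have "x \<in> orthant N" "inj_on x {..<N}"
      unfolding ws_weight_eq_laguerre_weight by (simp_all add: laguerre_weight_neq_0_iff)
    then show ?thesis
      using \<open>N \<noteq> 0\<close> \<beta> by (subst sum_T_field_divergence) auto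
  qed simp
  then have "(\<integral>x. \<beta> * (real N)\<^sup>2 / 2 * ?defect x * ws_weight \<beta> N x \<partial>ws_space N) = 0"
    using ws_integral_T_field_divergence[OF \<beta> degree] by (simp only:)
  then have "\<beta> * (real N)\<^sup>2 / 2 * ws_expect \<beta> N ?defect = 0"
    unfolding ws_expect_cmult[symmetric] by (simp only: ws_expect_def)
  then show ?thesis
    using \<open>N \<noteq> 0\<close> \<beta> by simp
qed

definition ws_moment :: "real \<Rightarrow> nat \<Rightarrow> nat list \<Rightarrow> real" where
  "ws_moment \<beta> N ks = ws_expect \<beta> N (T_prod N ks)"

lemma pole_order_le_sum_T_prod_pairs:
  "pole_order_le N (Suc (k + sum_list ks)) (\<lambda>x. \<Sum>a<k. T_prod N (Suc a # (k - a) # ks) x)"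
  by (intro pole_order_le_sum pole_order_le_T_prod_le) auto

lemma pole_order_le_T_prod_extract:
  assumes "add_mset j (mset js) = mset ks"
  shows "pole_order_le N (Suc (k + sum_list ks)) (\<lambda>x. real j * T_prod N ((j + k + 1) # js) x)"
  using mset_Cons_eqD(1)[OF assms] by (intro pole_order_le_cmult pole_order_le_T_prod_le) simp

lemma pole_order_le_T_loop_rhs: "pole_order_le N (Suc (k + sum_list ks)) (T_loop_rhs \<beta> N k ks)"
  unfolding T_loop_rhs_def[abs_def]
  by (intro pole_order_le_add pole_order_le_cmult pole_order_le_sum_extract pole_order_le_T_prod_le
      pole_order_le_sum_T_prod_pairs pole_order_le_T_prod_extract) simp_all

lemma ws_expect_T_loop_rhs:
  assumes \<beta>: "\<beta> \<ge> 1" and degree: "real (k + sum_list ks) + 2 \<le> \<beta> * real N / 2"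
  shows "ws_expect \<beta> N (T_loop_rhs \<beta> N k ks) = ws_moment \<beta> N (k # ks)
      + (\<Sum>a<k. ws_moment \<beta> N (Suc a # (k - a) # ks))
      + 2 / (\<beta> * (real N)\<^sup>2) * sum_extract (\<lambda>j js. real j * ws_moment \<beta> N ((j + k + 1) # js)) ks"
proof -
  define D where "D = Suc (k + sum_list ks)"
  have D: "real D + 1 \<le> \<beta> * real N / 2"
    using degree by (simp add: D_def)
  let ?e = "2 / (\<beta> * (real N)\<^sup>2)"
  let ?pairs = "\<lambda>x. \<Sum>a<k. T_prod N (Suc a # (k - a) # ks) x"
    and ?extraction = "\<lambda>x. sum_extract (\<lambda>j js. real j * T_prod N ((j + k + 1) # js) x) ks"
  have head: "pole_order_le N D (T_prod N (k # ks))"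
    by (rule pole_order_le_T_prod_le) (simp add: D_def)
  have pairs: "pole_order_le N D ?pairs"
    unfolding D_def by (rule pole_order_le_sum_T_prod_pairs)
  have extracted: "pole_order_le N D (\<lambda>x. real j * T_prod N ((j + k + 1) # js) x)"
    if "add_mset j (mset js) = mset ks" for j js
    unfolding D_def using that by (rule pole_order_le_T_prod_extract)
  have extraction: "pole_order_le N D (\<lambda>x. ?e * ?extraction x)"
    by (intro pole_order_le_cmult pole_order_le_sum_extract extracted)
  have "ws_expect \<beta> N (T_loop_rhs \<beta> N k ks)
      = ws_moment \<beta> N (k # ks) + ws_expect \<beta> N ?pairs + ?e * ws_expect \<beta> N ?extraction"
    unfolding T_loop_rhs_def[abs_def] ws_moment_def
    by (simp only: ws_expect_add[OF \<beta> D pole_order_le_add[OF head pairs] extraction]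
        ws_expect_add[OF \<beta> D head pairs] ws_expect_cmult)
  also have "ws_expect \<beta> N ?pairs = (\<Sum>a<k. ws_moment \<beta> N (Suc a # (k - a) # ks))"
    unfolding ws_moment_def
    by (intro ws_expect_sum[OF \<beta> D] pole_order_le_T_prod_le) (auto simp: D_def)
  also have "ws_expect \<beta> N ?extraction
      = sum_extract (\<lambda>j js. real j * ws_moment \<beta> N ((j + k + 1) # js)) ks"
    unfolding ws_moment_def ws_expect_cmult[symmetric]
    using extracted by (rule ws_expect_sum_extract[OF \<beta> D])
  finally show ?thesis .
qed

lemma ws_moment_loop_equation:
  assumes \<beta>: "\<beta> \<ge> 1" and degree: "real (k + sum_list ks) + 2 \<le> \<beta> * real N / 2"
  shows "(1 + real k / real N * (1 - 2 / \<beta>)) * ws_moment \<beta> N (Suc k # ks) = ws_moment \<beta> N (k # ks)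
      + (\<Sum>a<k. ws_moment \<beta> N (Suc a # (k - a) # ks))
      + 2 / (\<beta> * (real N)\<^sup>2) * sum_extract (\<lambda>j js. real j * ws_moment \<beta> N ((j + k + 1) # js)) ks"
proof -
  let ?r = "1 + real k / real N * (1 - 2 / \<beta>)" and ?D = "Suc (k + sum_list ks)"
  have D: "real ?D + 1 \<le> \<beta> * real N / 2"
    using degree by simp
  have lhs: "pole_order_le N ?D (\<lambda>x. ?r * T_prod N (Suc k # ks) x)"
    by (intro pole_order_le_cmult pole_order_le_T_prod_le) simp
  have rhs: "pole_order_le N ?D (\<lambda>x. - 1 * T_loop_rhs \<beta> N k ks x)"
    by (intro pole_order_le_cmult pole_order_le_T_loop_rhs)
  have "?r * ws_moment \<beta> N (Suc k # ks) + - 1 * ws_expect \<beta> N (T_loop_rhs \<beta> N k ks) = 0"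
    using ws_expect_loop_defect_eq_0[OF \<beta> degree]
    by (simp only: ws_moment_def ws_expect_add[OF \<beta> D lhs rhs] ws_expect_cmult)
  then show ?thesis
    using ws_expect_T_loop_rhs[OF \<beta> degree] by simp
qed

section \<open>Limits of the rescaled cumulants\<close>

lemma not_AE_laguerre_weight_eq_0: "\<not> (AE x in ws_space N. laguerre_weight \<gamma> a c N x = 0)"
proof
  interpret product_sigma_finite "\<lambda>_::nat. lborel :: real measure"
    by (rule ws_space_product_sigma_finite)
  define B where "B = (\<Pi>\<^sub>E i\<in>{..<N}. {2 * real i + 1 .. 2 * real i + 2})"
  have B: "B \<in> sets (ws_space N)"
    unfolding B_def ws_space_def by (rule sets_PiM_I_finite) auto
  have "laguerre_weight \<gamma> a c N x \<noteq> 0" if "x \<in> B" for x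
  proof -
    have bounds: "2 * real i + 1 \<le> x i" "x i \<le> 2 * real i + 2" if "i < N" for i
      using \<open>x \<in> B\<close> that by (auto simp: B_def PiE_iff)
    have "x i > 0" if "i < N" for i
      using bounds(1)[OF that] of_nat_0_le_iff[of i, where 'a = real] by linarith
    then have "x \<in> orthant N"
      by (simp add: orthant_def)
    moreover have "inj_on x {..<N}"
    proof (rule linorder_inj_onI')
      fix i j assume "i \<in> {..<N}" "j \<in> {..<N}" "i < j"
      then show "x i \<noteq> x j"
        using bounds(2)[of i] bounds(1)[of j] by simp
    qed
    ultimately show ?thesis
      by (simp add: laguerre_weight_neq_0_iff)
  qed
  moreover assume "AE x in ws_space N. laguerre_weight \<gamma> a c N x = 0"
  ultimately have "AE x in ws_space N. x \<notin> B"
    by (auto elim: eventually_mono)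
  then have "emeasure (ws_space N) B = 0"
    using AE_iff_measurable[OF B, of "\<lambda>x. x \<notin> B"] sets.sets_into_space[OF B] by auto
  moreover have "emeasure (ws_space N) B = 1"
    unfolding B_def ws_space_def by (subst emeasure_PiM) auto
  ultimately show False by simp
qed

lemma ws_partition_function_pos:
  assumes "\<beta> \<ge> 1" "1 \<le> \<beta> * real N / 2"
  shows "(\<integral>x. ws_weight \<beta> N x \<partial>ws_space N) > 0"
proof -
  have nonneg: "ws_weight \<beta> N x \<ge> 0" for x
    by (simp add: ws_weight_eq_laguerre_weight laguerre_weight_nonneg)
  have "integrable (ws_space N) (ws_weight \<beta> N)"
    using integrable_mult_ws_weight[OF assms(1) _ pole_order_le_const[of N 1]] assms(2) by simp
  then have "(\<integral>x. ws_weight \<beta> N x \<partial>ws_space N) \<noteq> 0"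
    using integral_nonneg_eq_0_iff_AE[of "ws_space N" "ws_weight \<beta> N"] nonneg not_AE_laguerre_weight_eq_0
    by (simp add: ws_weight_eq_laguerre_weight)
  then show ?thesis
    using nonneg by (simp add: less_le Bochner_Integration.integral_nonneg)
qed

lemma ws_moment_Nil:
  assumes "\<beta> \<ge> 1" "1 \<le> \<beta> * real N / 2"
  shows "ws_moment \<beta> N [] = 1"
  using ws_partition_function_pos[OF assms] by (simp add: ws_moment_def ws_expect_def)

lemma ws_moment_Cons_0: "N > 0 \<Longrightarrow> ws_moment \<beta> N (0 # ks) = ws_moment \<beta> N ks"
  by (simp add: ws_moment_def ws_T_def)

lemma prod_list_map_nths:
  assumes "I \<subseteq> {..<length xs}"
  shows "(\<Prod>x\<leftarrow>nths xs I. f x) = (\<Prod>i\<in>I. f (xs ! i))"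
proof -
  have "(\<Prod>x\<leftarrow>nths xs I. f x) = (\<Prod>i<length xs. if i \<in> I then f (xs ! i) else 1)"
    by (induction xs arbitrary: I)
      (simp_all add: nths_Cons prod.lessThan_Suc_shift del: prod.lessThan_Suc cong: if_cong)
  then show ?thesis
    using assms by (simp add: Int_absorb1 flip: prod.inter_restrict)
qed

lemma ws_cumulant_eq_list_cumulant: "ws_cumulant \<beta> N ks = list_cumulant (ws_moment \<beta> N) ks"
proof -
  have "ws_cumulant \<beta> N ks
      = joint_cumulant (\<lambda>P. ws_expect \<beta> N (\<lambda>x. \<Prod>i\<in>P. ws_T (ks ! i) N x)) {..<length ks}"
    by (simp add: ws_cumulant_def joint_cumulant_def moebius_coeff_def)
  also have "\<dots> = list_cumulant (ws_moment \<beta> N) ks"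
    unfolding list_cumulant_def
    by (rule joint_cumulant_cong) (simp add: ws_moment_def prod_list_map_nths)
  finally show ?thesis .
qed

definition scaled_cumulant :: "real \<Rightarrow> nat \<Rightarrow> nat list \<Rightarrow> real" where
  "scaled_cumulant \<beta> N ks = (\<beta> * (real N)\<^sup>2) ^ (length ks - 1) * ws_cumulant \<beta> N ks"

lemma rescaled_loop_equation:
  fixes K :: "nat list \<Rightarrow> real"
  assumes "h \<noteq> 0"
    and loop: "r * K (Suc k # ks) = K (k # ks)
       + (\<Sum>a<k. K (Suc a # (k - a) # ks) + ((\<lambda>js. K (Suc a # js)) \<star> (\<lambda>js. K ((k - a) # js))) ks)
       + 2 / h * sum_extract (\<lambda>j js. real j * K ((j + k + 1) # js)) ks"
  defines "c \<equiv> \<lambda>js. h ^ (length js - 1) * K js"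
  shows "r * c (Suc k # ks) = c (k # ks)
       + (\<Sum>a<k. 1 / h * c (Suc a # (k - a) # ks) + ((\<lambda>js. c (Suc a # js)) \<star> (\<lambda>js. c ((k - a) # js))) ks)
       + 2 * sum_extract (\<lambda>j js. real j * c ((j + k + 1) # js)) ks"
proof -
  have c_Cons: "c (j # js) = h ^ length js * K (j # js)" for j js
    by (simp add: c_def)
  have pair: "1 / h * c (i # j # ks) = h ^ length ks * K (i # j # ks)" for i j
    using \<open>h \<noteq> 0\<close> by (simp add: c_Cons)
  have product: "((\<lambda>js. c (i # js)) \<star> (\<lambda>js. c (j # js))) ks
      = h ^ length ks * ((\<lambda>js. K (i # js)) \<star> (\<lambda>js. K (j # js))) ks" for i j
    by (simp only: c_Cons list_convolution_length_power)
  have extraction: "sum_extract (\<lambda>j js. real j * c ((j + k + 1) # js)) ks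
      = h ^ length ks / h * sum_extract (\<lambda>j js. real j * K ((j + k + 1) # js)) ks"
    unfolding sum_extract_mult_left[symmetric]
    using \<open>h \<noteq> 0\<close> mset_Cons_eqD(2)[of _ _ ks] by (intro sum_extract_cong refl) (simp add: c_Cons)
  have "r * c (Suc k # ks) = h ^ length ks * (r * K (Suc k # ks))"
    by (simp only: c_Cons mult.left_commute)
  then show ?thesis
    unfolding loop c_Cons[of k ks] pair product extraction
    by (simp add: distrib_left sum_distrib_left mult_ac)
qed

lemma scaled_cumulant_loop_equation:
  assumes \<beta>: "\<beta> \<ge> 1" and degree: "real (k + sum_list ks) + 2 \<le> \<beta> * real N / 2"
  defines "c \<equiv> scaled_cumulant \<beta> N"
  shows "(1 + real k / real N * (1 - 2 / \<beta>)) * c (Suc k # ks) = c (k # ks)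
       + (\<Sum>a<k. 1 / (\<beta> * (real N)\<^sup>2) * c (Suc a # (k - a) # ks)
           + ((\<lambda>js. c (Suc a # js)) \<star> (\<lambda>js. c ((k - a) # js))) ks)
       + 2 * sum_extract (\<lambda>j js. real j * c ((j + k + 1) # js)) ks"
  unfolding c_def scaled_cumulant_def ws_cumulant_eq_list_cumulant
proof (intro rescaled_loop_equation list_cumulant_loop_equation)
  have degree_0: "1 \<le> \<beta> * real N / 2"
    using degree by linarith
  then have "N \<noteq> 0"
    by (intro notI) simp
  then show "\<beta> * (real N)\<^sup>2 \<noteq> 0"
    using \<beta> by simp
  show "ws_moment \<beta> N [] = 1"
    using \<beta> degree_0 by (rule ws_moment_Nil)
  fix js assume "subseq js ks"
  then have "real (k + sum_list js) + 2 \<le> \<beta> * real N / 2"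
    using degree subseq_sum_list_le[of js ks] by linarith
  then show "(1 + real k / real N * (1 - 2 / \<beta>)) * ws_moment \<beta> N (Suc k # js) = ws_moment \<beta> N (k # js)
      + (\<Sum>a<k. ws_moment \<beta> N (Suc a # (k - a) # js))
      + 2 / (\<beta> * (real N)\<^sup>2) * sum_extract (\<lambda>j js. real j * ws_moment \<beta> N ((j + k + 1) # js)) js"
    by (rule ws_moment_loop_equation[OF \<beta>])
qed

lemma scaled_cumulant_Cons_0:
  assumes "\<beta> \<ge> 1" "1 \<le> \<beta> * real N / 2"
  shows "scaled_cumulant \<beta> N (0 # ks) = of_bool (ks = [])"
proof -
  have "N > 0"
    using assms(2) by (intro gr0I) simp
  then have "list_cumulant (ws_moment \<beta> N) (0 # ks) = of_bool (ks = [])"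
    using assms by (intro list_cumulant_Cons_neutral ws_moment_Nil ws_moment_Cons_0)
  then show ?thesis
    by (simp add: scaled_cumulant_def ws_cumulant_eq_list_cumulant)
qed

lemma loop_equations_scaled_cumulant:
  assumes \<beta>: "\<beta> \<ge> 1"
  shows "loop_equations (scaled_cumulant \<beta>)
    (\<lambda>N k. 1 + real k / real N * (1 - 2 / \<beta>)) (\<lambda>N. 1 / (\<beta> * (real N)\<^sup>2))"
proof
  have large: "\<forall>\<^sub>F N in sequentially. real d + 2 \<le> \<beta> * real N / 2" for d
    using \<beta> by real_asymp
  show "(\<lambda>N. 1 + real k / real N * (1 - 2 / \<beta>)) \<longlonglongrightarrow> 1" for k
    by real_asymp
  show "(\<lambda>N. 1 / (\<beta> * (real N)\<^sup>2)) \<longlonglongrightarrow> 0"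
    using \<beta> by real_asymp
  show "(\<lambda>N. scaled_cumulant \<beta> N (0 # ks)) \<longlonglongrightarrow> of_bool (ks = [])" for ks
  proof (rule tendsto_eventually)
    show "\<forall>\<^sub>F N in sequentially. scaled_cumulant \<beta> N (0 # ks) = of_bool (ks = [])"
      using large[of 0] by eventually_elim (rule scaled_cumulant_Cons_0[OF \<beta>], simp)
  qed
  show "\<forall>\<^sub>F N in sequentially. (1 + real k / real N * (1 - 2 / \<beta>)) * scaled_cumulant \<beta> N (Suc k # ks) =
      scaled_cumulant \<beta> N (k # ks)
      + (\<Sum>a<k. 1 / (\<beta> * (real N)\<^sup>2) * scaled_cumulant \<beta> N (Suc a # (k - a) # ks)
          + ((\<lambda>js. scaled_cumulant \<beta> N (Suc a # js)) \<star> (\<lambda>js. scaled_cumulant \<beta> N ((k - a) # js))) ks)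
      + 2 * sum_extract (\<lambda>j js. real j * scaled_cumulant \<beta> N ((j + k + 1) # js)) ks" for k ks
    using large[of "k + sum_list ks"] by eventually_elim (rule scaled_cumulant_loop_equation[OF \<beta>])
qed

lemma alpha_in_Nat_nonempty:
  assumes "\<beta> \<ge> 1" "ks \<noteq> []"
  shows "alpha_in_Nat \<beta> ks"
proof -
  interpret loop_equations "scaled_cumulant \<beta>"
    "\<lambda>N k. 1 + real k / real N * (1 - 2 / \<beta>)" "\<lambda>N. 1 / (\<beta> * (real N)\<^sup>2)"
    using assms(1) by (rule loop_equations_scaled_cumulant)
  have "(\<lambda>N. scaled_cumulant \<beta> N ks) \<longlonglongrightarrow> real (loop_limit ks)"
    using assms(2) by (rule tendsto_loop_limit)
  then show ?thesis
    unfolding alpha_in_Nat_def scaled_cumulant_def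
    by (intro exI[of _ "loop_limit ks"]) (simp add: power_mult_distrib power_mult)
qed

theorem theorem2:
  fixes \<beta> :: real
  assumes "\<beta> \<in> {1, 2, 4}"
  shows "(\<forall>\<kappa>. alpha_in_Nat \<beta> [\<kappa>])
       \<and> (\<forall>\<kappa>1 \<kappa>2. alpha_in_Nat \<beta> [\<kappa>1, \<kappa>2])
       \<and> (\<forall>\<kappa>1 \<kappa>2 \<kappa>3. alpha_in_Nat \<beta> [\<kappa>1, \<kappa>2, \<kappa>3])
       \<and> (\<forall>v\<ge>1. alpha_in_Nat \<beta> (replicate v 1))"
proof -
  have "\<beta> \<ge> 1" using assms by auto
  then show ?thesis by (auto intro!: alpha_in_Nat_nonempty)
qed

end
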